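(* Let $G$ be a connected unicyclic graph of order $n$ with $k$ internal edges, $r$ non-trivial rooted trees attached to its cycle, and cycle of size $c\ge3$. Let $\mathbf{X}_G=\sum_{\lambda\vdash n}c_\lambda\,\mathfrak{st}_\lambda$ be its star-expansion, and let $\lambda^\star=(n-m_1,1^{m_1})$ be the longest hook partition (i.e. with the largest number of parts) such that $c_{\lambda^\star}\ne0$. Then \[k=\begin{cases}m_1+2&\text{if } r=0\text{ or }1,\\ m_1+1&\text{if } r\ge2.\end{cases}\] Furthermore, the coefficient corresponding to the longest hook partition is \[c_{\lambda^\star}=\begin{cases}(-1)^{k-2}&\text{if } r=0,\\(-1)^{k-2}(c-1)&\text{if } r=1,\\(-1)^{k-1}(r-1)&\text{if } r\ge2.\end{cases}\]
   Context: All graphs are finite and simple. The chromatic symmetric function of a graph $G$ with vertices $v_1,\dots,v_n$ is $\mathbf{X}_G=\sum_\kappa x_{\kappa(v_1)}\cdots x_{\kappa(v_n)}$, summed over all proper colorings $\kappa:V(G)\to\mathbb{N}$. The star graph $\mathsf{St}_k$ on $k$ vertices is the tree with one central vertex adjacent to $k-1$ leaves ($\mathsf{St}_1$ is a single vertex); $\mathfrak{st}_k:=\mathbf{X}_{\mathsf{St}_k}$, and $\mathfrak{st}_\lambda:=\mathfrak{st}_{\lambda_1}\mathfrak{st}_{\lambda_2}\cdots$ for a partition $\lambda$. The set $\{\mathfrak{st}_\lambda:\lambda\vdash n\}$ is a $\mathbb{Q}$-basis (the star-basis) of the space of homogeneous symmetric functions of degree $n$, so the coefficients $c_\lambda$ are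 uniquely determined. A hook partition of $n$ is a partition of the form $(n-m_1,1^{m_1})$, $0\le m_1\le n-1$. A unicyclic graph is a graph containing exactly one cycle. If $G$ is connected unicyclic with cycle vertices $v_1,\dots,v_c$, then deleting the edges of the cycle leaves $c$ trees $T_1,\dots,T_c$ with $T_i$ containing (and rooted at) $v_i$; $T_i$ is non-trivial if it has more than one vertex, and $r$ is the number of non-trivial $T_i$. An internal vertex is a vertex of degree at least two; an internal edge is an edge both of whose endpoints are internal vertices. *)

theory Defs
  imports Complex_Main "HOL-Library.Multiset" "HOL-Library.FuncSet"
begin

section \<open>Formal power series in countably many commuting variables\<close>

text \<open>
  The multiset \<open>{#i1, \<dots>, id#}\<close> stands for the monomial \<open>x_i1 \<dots> x_id\<close>, so that multiplication of
  monomials is addition of multisets, and a series is the family of its coefficients.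
\<close>

typedef 'a series = "UNIV :: (nat multiset \<Rightarrow> 'a) set"
  morphisms coeff Series ..

setup_lifting type_definition_series

lemma finite_submultisets: "finite {A. A \<subseteq># (M :: 'b multiset)}"
proof (induction M)
  case empty
  then show ?case by simp
next
  case (add x M)
  have "{A. A \<subseteq># add_mset x M} \<subseteq> {A. A \<subseteq># M} \<union> add_mset x ` {A. A \<subseteq># M}"
  proof
    fix A assume "A \<in> {A. A \<subseteq># add_mset x M}"
    then have A: "A \<subseteq># add_mset x M" by simp
    show "A \<in> {A. A \<subseteq># M} \<union> add_mset x ` {A. A \<subseteq># M}"
    proof (cases "x \<in># A")
      case True
      then obtain B where "A = add_mset x B" by (meson multi_member_split)
      then show ?thesis using A by auto
    next
      case False
      have "count A y \<le> count M y" for y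
        using mset_subset_eq_count[OF A, of y] False by (cases "y = x") (auto simp: not_in_iff)
      then show ?thesis by (simp add: subseteq_mset_def)
    qed
  qed
  then show ?case using add.IH by (meson finite_UnI finite_imageI finite_subset)
qed

lemma finite_splits: "finite {(A, B). A + B = (M :: 'b multiset)}"
  by (rule finite_subset[of _ "{A. A \<subseteq># M} \<times> {A. A \<subseteq># M}"]) (auto simp: finite_submultisets)

instantiation series :: (comm_ring_1) comm_ring_1
begin

lift_definition zero_series :: "'a series" is "\<lambda>M. 0" .
lift_definition one_series :: "'a series" is "\<lambda>M. if M = {#} then 1 else 0" .
lift_definition plus_series :: "'a series \<Rightarrow> 'a series \<Rightarrow> 'a series" is "\<lambda>f g M. f M + g M" .
lift_definition minus_series :: "'a series \<Rightarrow> 'a series \<Rightarrow> 'a series" is "\<lambda>f g M. f M - g M" .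
lift_definition uminus_series :: "'a series \<Rightarrow> 'a series" is "\<lambda>f M. - f M" .
lift_definition times_series :: "'a series \<Rightarrow> 'a series \<Rightarrow> 'a series"
  is "\<lambda>f g M. \<Sum>(A, B) \<in> {(A, B). A + B = M}. f A * g B" .

instance
proof
  fix f g h :: "'a series"
  show "f * g * h = f * (g * h)"
  proof (transfer, rule ext)
    fix f g h :: "nat multiset \<Rightarrow> 'a" and M :: "nat multiset"
    let ?S = "\<lambda>M. {(A :: nat multiset, B). A + B = M}"
    have "(\<Sum>(A, B)\<in>?S M. (\<Sum>(C, D)\<in>?S A. f C * g D) * h B)
        = (\<Sum>p\<in>?S M. \<Sum>q\<in>?S (fst p). f (fst q) * g (snd q) * h (snd p))"
      by (simp add: case_prod_beta sum_distrib_right)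
    also have "\<dots> = (\<Sum>(p, q)\<in>(SIGMA p:?S M. ?S (fst p)). f (fst q) * g (snd q) * h (snd p))"
      by (rule sum.Sigma) (auto simp: finite_splits)
    also have "\<dots> = (\<Sum>(p, q)\<in>(SIGMA p:?S M. ?S (snd p)). f (fst p) * (g (fst q) * h (snd q)))"
      by (rule sum.reindex_bij_witness[
            where i = "\<lambda>((A, B), (C, D)). ((A + C, D), (A, C))"
              and j = "\<lambda>((A, B), (C, D)). ((C, D + B), (D, B))"]) (auto simp: ac_simps)
    also have "\<dots> = (\<Sum>p\<in>?S M. \<Sum>q\<in>?S (snd p). f (fst p) * (g (fst q) * h (snd q)))"
      by (rule sum.Sigma[symmetric]) (auto simp: finite_splits)
    also have "\<dots> = (\<Sum>(A, B)\<in>?S M. f A * (\<Sum>(C, D)\<in>?S B. g C * h D))"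
      by (simp add: case_prod_beta sum_distrib_left)
    finally show "(\<Sum>(A, B)\<in>?S M. (\<Sum>(C, D)\<in>?S A. f C * g D) * h B) =
        (\<Sum>(A, B)\<in>?S M. f A * (\<Sum>(C, D)\<in>?S B. g C * h D))" .
  qed
  show "f * g = g * f"
  proof (transfer, rule ext)
    fix f g :: "nat multiset \<Rightarrow> 'a" and M :: "nat multiset"
    show "(\<Sum>(A, B)\<in>{(A, B). A + B = M}. f A * g B) = (\<Sum>(A, B)\<in>{(A, B). A + B = M}. g A * f B)"
      by (rule sum.reindex_bij_witness[where i = prod.swap and j = prod.swap])
        (auto simp: ac_simps)
  qed
  show "1 * f = f"
  proof (transfer, rule ext)
    fix f :: "nat multiset \<Rightarrow> 'a" and M :: "nat multiset"
    have "(\<Sum>(A, B)\<in>{(A, B). A + B = M}. (if A = {#} then 1 else 0) * f B)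
        = (\<Sum>(A, B)\<in>{({#} :: nat multiset, M)}. (if A = {#} then 1 else 0) * f B)"
      by (rule sum.mono_neutral_right) (auto simp: finite_splits split: if_splits)
    then show "(\<Sum>(A, B)\<in>{(A, B). A + B = M}. (if A = {#} then 1 else 0) * f B) = f M"
      by simp
  qed
  show "(f + g) * h = f * h + g * h"
    by (transfer, rule ext) (simp add: case_prod_beta distrib_right sum.distrib)
  show "(0 :: 'a series) \<noteq> 1"
    by transfer (metis zero_neq_one)
qed (transfer; auto simp: algebra_simps)+

end

lift_definition scale :: "'a::comm_ring_1 \<Rightarrow> 'a series \<Rightarrow> 'a series" is "\<lambda>a f M. a * f M" .


section \<open>Finite simple graphs\<close>

text \<open>A graph is given by its vertex set and its set of edges, an edge being a two-element set.\<close>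

definition simple_graph :: "'v set \<Rightarrow> 'v set set \<Rightarrow> bool" where
  "simple_graph V E \<longleftrightarrow> finite V \<and> (\<forall>e\<in>E. e \<subseteq> V \<and> card e = 2)"

definition component :: "'v set set \<Rightarrow> 'v \<Rightarrow> 'v set" where
  "component E v = {w. (v, w) \<in> {(x, y). {x, y} \<in> E}\<^sup>*}"

definition connected_graph :: "'v set \<Rightarrow> 'v set set \<Rightarrow> bool" where
  "connected_graph V E \<longleftrightarrow> V \<noteq> {} \<and> (\<forall>v\<in>V. \<forall>w\<in>V. w \<in> component E v)"

text \<open>
  A cycle, as a subgraph, is identified with its edge set \<open>C\<close>: rotations and reversals of a
  cyclic vertex sequence give the same cycle. Its vertices are those of \<open>\<Union>C\<close>.
\<close>

definition is_cycle :: "'v set set \<Rightarrow> 'v set set \<Rightarrow> bool" where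
  "is_cycle E C \<longleftrightarrow> C \<subseteq> E \<and>
     (\<exists>vs. distinct vs \<and> length vs \<ge> 3 \<and>
        C = (\<lambda>i. {vs ! i, vs ! (Suc i mod length vs)}) ` {..<length vs})"

definition unicyclic :: "'v set set \<Rightarrow> bool" where
  "unicyclic E \<longleftrightarrow> (\<exists>!C. is_cycle E C)"

definition degree :: "'v set set \<Rightarrow> 'v \<Rightarrow> nat" where
  "degree E v = card {e \<in> E. v \<in> e}"

definition internal_edges :: "'v set set \<Rightarrow> 'v set set" where
  "internal_edges E = {e \<in> E. \<forall>v\<in>e. degree E v \<ge> 2}"

text \<open>
  When \<open>C\<close> is the cycle of a connected unicyclic graph, the tree \<open>T_i\<close> rooted at the cycle vertex
  \<open>v_i\<close> is the component of \<open>v_i\<close> after the edges of \<open>C\<close> have been deleted; the non-trivial trees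
  are counted through their roots.
\<close>

definition nontrivial_roots :: "'v set set \<Rightarrow> 'v set set \<Rightarrow> 'v set" where
  "nontrivial_roots E C = {v \<in> \<Union>C. card (component (E - C) v) > 1}"


section \<open>Chromatic symmetric functions and the star basis\<close>

definition proper_colorings :: "'v set \<Rightarrow> 'v set set \<Rightarrow> ('v \<Rightarrow> nat) set" where
  "proper_colorings V E =
     {\<kappa> \<in> V \<rightarrow>\<^sub>E UNIV. \<forall>u\<in>V. \<forall>v\<in>V. {u, v} \<in> E \<longrightarrow> \<kappa> u \<noteq> \<kappa> v}"

text \<open>
  The infinite sum of the monomials of all proper colorings: the coefficient of a monomial \<open>M\<close>
  is the number of proper colorings whose monomial is \<open>M\<close>, which is finite.
\<close>

definition chromatic_symmetric_function :: "'v set \<Rightarrow> 'v set set \<Rightarrow> rat series" where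
  "chromatic_symmetric_function V E =
     Series (\<lambda>M. of_nat (card {\<kappa> \<in> proper_colorings V E. image_mset \<kappa> (mset_set V) = M}))"

lemma finite_colorings_of_monomial:
  assumes "finite V"
  shows "finite {\<kappa> \<in> proper_colorings V E. image_mset \<kappa> (mset_set V) = M}"
proof (rule finite_subset)
  show "{\<kappa> \<in> proper_colorings V E. image_mset \<kappa> (mset_set V) = M} \<subseteq> V \<rightarrow>\<^sub>E set_mset M"
    using assms by (auto simp: proper_colorings_def PiE_iff extensional_def)
  show "finite (V \<rightarrow>\<^sub>E set_mset M)"
    using assms by (auto intro: finite_PiE)
qed

definition star_edges :: "nat \<Rightarrow> nat set set" where
  "star_edges k = (\<lambda>i. {0, i}) ` {1..<k}"

definition st :: "nat \<Rightarrow> rat series" where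
  "st k = chromatic_symmetric_function {..<k} (star_edges k)"

text \<open>A partition is the multiset of its (positive) parts.\<close>

definition partitions :: "nat \<Rightarrow> nat multiset set" where
  "partitions n = {l. sum_mset l = n \<and> 0 \<notin># l}"

lemma finite_partitions: "finite (partitions n)"
proof (rule finite_subset)
  let ?B = "\<lambda>n. {A. A \<subseteq># (\<Sum>i\<in>{..n}. replicate_mset n i)}"
  show "finite (?B n)" by (rule finite_submultisets)
  show "partitions n \<subseteq> ?B n"
  proof
    fix l assume "l \<in> partitions n"
    then have l: "sum_mset l = n" "0 \<notin># l" by (auto simp: partitions_def)
    have size: "size l \<le> sum_mset l" using l(2) by (induction l) auto
    have "count l i \<le> count (\<Sum>i\<in>{..n}. replicate_mset n i) i" for i
    proof (cases "i \<in># l")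
      case True
      then have "i \<le> n" using l(1) by (auto dest: multi_member_split)
      moreover have "count l i \<le> n" using size l(1) count_le_size[of l i] by linarith
      ultimately show ?thesis by (simp add: count_sum)
    next
      case False
      then show ?thesis by (simp add: not_in_iff)
    qed
    then show "l \<in> ?B n" by (simp add: subseteq_mset_def)
  qed
qed

definition st_partition :: "nat multiset \<Rightarrow> rat series" where
  "st_partition l = (\<Prod>k\<in>#l. st k)"

text \<open>\<open>hook n m\<close> is the hook partition \<open>(n - m, 1^m)\<close>, with \<open>m + 1\<close> parts when \<open>m < n\<close>.\<close>

definition hook :: "nat \<Rightarrow> nat \<Rightarrow> nat multiset" where
  "hook n m = add_mset (n - m) (replicate_mset m 1)"

definition star_expansion :: "rat series \<Rightarrow> nat \<Rightarrow> (nat multiset \<Rightarrow> rat) \<Rightarrow> bool" where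
  "star_expansion X n a \<longleftrightarrow> X = (\<Sum>l\<in>partitions n. scale (a l) (st_partition l))"

definition longest_hook :: "nat \<Rightarrow> (nat multiset \<Rightarrow> rat) \<Rightarrow> nat \<Rightarrow> bool" where
  "longest_hook n a m \<longleftrightarrow> m < n \<and> a (hook n m) \<noteq> 0 \<and>
     (\<forall>m'<n. a (hook n m') \<noteq> 0 \<longrightarrow> m' \<le> m)"

end

theory Submission imports "HOL-Computational_Algebra.Polynomial" Defs begin

text \<open>
  Evaluating \<open>X_G\<close> at \<open>x_0 = t\<close>, \<open>x_1 = \<dots> = x_q = 1\<close> gives a polynomial in \<open>q\<close>. A star with at least
  two vertices evaluates to a multiple of \<open>q\<close>, so only hook partitions contribute to the
  coefficient of \<open>q\<close>; the hook \<open>(n - m, 1^m)\<close> contributes \<open>t^m (t - 1)^(n - m - 1)\<close>, up to a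
  correction when \<open>m = n - 2\<close>. For a unicyclic graph with \<open>l\<close> leaves, the same coefficient is
  computed from the cycle by adding pendant vertices. Tracking a separate weight \<open>\<tau> v\<close> for
  colour 0 at each vertex closes this recursion: a pendant vertex \<open>v\<close> at \<open>u\<close> multiplies the
  coefficient by \<open>\<tau> v - 1\<close> and sets \<open>\<tau> u\<close> to 0. The result is
  \<open>(-1)^(n - 1 - l) (t - 1)^l ((c - 1) - (c - r) t)\<close>, and comparing both sides as polynomials in
  \<open>(t - 1) / t\<close> gives every hook coefficient. The number of internal edges is \<open>n - l\<close>.
\<close>

section \<open>Weighted colourings\<close>

text \<open>Colour 0 is kept apart from the \<open>q\<close> colours 1, ..., \<open>q\<close>, so
  that the polynomial variable \<open>q\<close> counts the colours of weight 1.\<close>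

definition colorings :: "nat \<Rightarrow> 'v set \<Rightarrow> 'v set set \<Rightarrow> ('v \<Rightarrow> nat) set" where
  "colorings q V E =
     {\<kappa> \<in> V \<rightarrow>\<^sub>E {..q}. \<forall>u\<in>V. \<forall>v\<in>V. {u, v} \<in> E \<longrightarrow> \<kappa> u \<noteq> \<kappa> v}"

definition weight :: "('v \<Rightarrow> rat) \<Rightarrow> 'v \<Rightarrow> nat \<Rightarrow> rat" where
  "weight \<tau> v i = (if i = 0 then \<tau> v else 1)"

definition wsum :: "nat \<Rightarrow> ('v \<Rightarrow> rat) \<Rightarrow> 'v set \<Rightarrow> 'v set set \<Rightarrow> rat" where
  "wsum q \<tau> V E = (\<Sum>\<kappa>\<in>colorings q V E. \<Prod>v\<in>V. weight \<tau> v (\<kappa> v))"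

lemma finite_colorings: "finite V \<Longrightarrow> finite (colorings q V E)"
  by (rule finite_subset[of _ "V \<rightarrow>\<^sub>E {..q}"]) (auto simp: colorings_def intro: finite_PiE)

lemma colorings_insert_vertex:
  assumes "z \<notin> V" "N \<subseteq> V" "\<forall>e\<in>E. e \<subseteq> V"
  shows "colorings q (insert z V) (E \<union> (\<lambda>x. {x, z}) ` N) =
    (\<lambda>(\<kappa>, i). \<kappa>(z := i)) ` (SIGMA \<kappa>:colorings q V E. {..q} - \<kappa> ` N)" (is "?L = ?R")
proof
  show "?L \<subseteq> ?R"
  proof
    fix \<kappa> assume k: "\<kappa> \<in> ?L"
    let ?k = "restrict \<kappa> V"
    have 1: "?k \<in> colorings q V E"
      using k by (auto simp: colorings_def PiE_iff)
    have 2: "\<kappa> z \<in> {..q} - ?k ` N"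
    proof -
      have "\<kappa> x \<noteq> \<kappa> z" if "x \<in> N" for x
        using k that assms(2) by (auto simp: colorings_def)
      moreover have "\<kappa> z \<le> q" using k by (auto simp: colorings_def PiE_iff)
      ultimately show ?thesis using assms(2) by (auto simp: image_iff) (metis subsetD)
    qed
    have 3: "\<kappa> = ?k(z := \<kappa> z)"
      using k assms(1) by (auto simp: colorings_def PiE_iff extensional_def fun_eq_iff)
    show "\<kappa> \<in> ?R"
      by (rule image_eqI[where x = "(?k, \<kappa> z)"]) (use 1 2 3 in auto)
  qed
  show "?R \<subseteq> ?L"
  proof
    fix \<kappa>' assume "\<kappa>' \<in> ?R"
    then obtain \<kappa> i where k: "\<kappa> \<in> colorings q V E" and i: "i \<in> {..q}" "i \<notin> \<kappa> ` N"
      and eq: "\<kappa>' = \<kappa>(z := i)" by auto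
    have "\<kappa> \<in> V \<rightarrow>\<^sub>E {..q}" using k by (simp add: colorings_def)
    then have "\<kappa>(z := i) \<in> insert z V \<rightarrow>\<^sub>E {..q}"
      using i by (auto simp: PiE_iff extensional_def)
    moreover have "(\<kappa>(z := i)) u \<noteq> (\<kappa>(z := i)) v"
      if "u \<in> insert z V" "v \<in> insert z V" "{u, v} \<in> E \<union> (\<lambda>x. {x, z}) ` N" for u v
    proof (cases "{u, v} \<in> E")
      case True
      then have "u \<in> V" "v \<in> V" using assms(3) by auto
      then show ?thesis using True k assms(1) by (auto simp: colorings_def)
    next
      case False
      with that(3) obtain x where "x \<in> N" "{u, v} = {x, z}" by blast
      moreover have "x \<noteq> z" using \<open>x \<in> N\<close> assms by auto
      ultimately show ?thesis using i(2) by (auto simp: doubleton_eq_iff)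
    qed
    ultimately show "\<kappa>' \<in> ?L" unfolding colorings_def eq by blast
  qed
qed

text \<open>The new vertex \<open>z\<close> has neighbours in \<open>N\<close> only, so a colouring
  of the rest extends by any colour absent from \<open>N\<close>. Isolated and pendant vertices, and
  the vertex to be contracted, are the cases where \<open>N\<close> has zero, one or two
  elements.\<close>

lemma wsum_insert_vertex:
  assumes "finite V" "z \<notin> V" "N \<subseteq> V" "\<forall>e\<in>E. e \<subseteq> V"
  shows "wsum q \<tau> (insert z V) (E \<union> (\<lambda>x. {x, z}) ` N) =
    (\<Sum>\<kappa>\<in>colorings q V E. (\<Prod>v\<in>V. weight \<tau> v (\<kappa> v)) * (\<Sum>i\<in>{..q} - \<kappa> ` N. weight \<tau> z i))"
proof -
  let ?S = "SIGMA \<kappa>:colorings q V E. {..q} - \<kappa> ` N"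
  have inj: "inj_on (\<lambda>(\<kappa>, i). \<kappa>(z := i)) ?S"
  proof (rule inj_onI, clarify, rule conjI)
    fix \<kappa> i \<kappa>' j
    assume k: "\<kappa> \<in> colorings q V E" "\<kappa>' \<in> colorings q V E" and eq: "\<kappa>(z := i) = \<kappa>'(z := j)"
    show "\<kappa> = \<kappa>'"
    proof
      fix x show "\<kappa> x = \<kappa>' x"
        using fun_cong[OF eq, of x] k assms(2)
        by (cases "x = z") (auto simp: colorings_def PiE_iff extensional_def)
    qed
    show "i = j" using fun_cong[OF eq, of z] by simp
  qed
  have "wsum q \<tau> (insert z V) (E \<union> (\<lambda>x. {x, z}) ` N) =
      (\<Sum>(\<kappa>, i)\<in>?S. \<Prod>v\<in>insert z V. weight \<tau> v ((\<kappa>(z := i)) v))"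
    unfolding wsum_def colorings_insert_vertex[OF assms(2-4)]
    by (subst sum.reindex[OF inj]) (simp add: case_prod_beta comp_def)
  also have "\<dots> = (\<Sum>(\<kappa>, i)\<in>?S. (\<Prod>v\<in>V. weight \<tau> v (\<kappa> v)) * weight \<tau> z i)"
  proof (intro sum.cong refl, clarify)
    fix \<kappa> i
    have "(\<Prod>v\<in>V. weight \<tau> v ((\<kappa>(z := i)) v)) = (\<Prod>v\<in>V. weight \<tau> v (\<kappa> v))"
      using assms(2) by (intro prod.cong) auto
    then show "(\<Prod>v\<in>insert z V. weight \<tau> v ((\<kappa>(z := i)) v)) = (\<Prod>v\<in>V. weight \<tau> v (\<kappa> v)) * weight \<tau> z i"
      using assms(1,2) by (simp del: fun_upd_apply add: mult.commute) simp
  qed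
  also have "\<dots> = (\<Sum>\<kappa>\<in>colorings q V E. \<Sum>i\<in>{..q} - \<kappa> ` N. (\<Prod>v\<in>V. weight \<tau> v (\<kappa> v)) * weight \<tau> z i)"
    by (rule sum.Sigma[symmetric]) (auto simp: finite_colorings assms)
  finally show ?thesis by (simp add: sum_distrib_left)
qed

lemma sum_weight_atMost: "(\<Sum>i\<le>q. weight \<tau> z i) = \<tau> z + of_nat q"
  by (induction q) (simp_all add: weight_def)

lemma sum_weight_remove:
  "j \<le> q \<Longrightarrow> (\<Sum>i\<in>{..q} - {j}. weight \<tau> z i) = \<tau> z + of_nat q - weight \<tau> z j"
  by (simp add: sum_diff1 sum_weight_atMost)

lemma prod_weight_upd:
  assumes "finite V" "u \<in> V"
  shows "(\<Prod>v\<in>V. weight (\<tau>(u := x)) v (\<kappa> v)) = weight (\<tau>(u := x)) u (\<kappa> u) * (\<Prod>v\<in>V - {u}. weight \<tau> v (\<kappa> v))"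
proof -
  have "(\<Prod>v\<in>V - {u}. weight (\<tau>(u := x)) v (\<kappa> v)) = (\<Prod>v\<in>V - {u}. weight \<tau> v (\<kappa> v))"
    by (rule prod.cong) (auto simp: weight_def)
  then show ?thesis using assms by (simp add: prod.remove)
qed

text \<open>Split by the colour of \<open>u\<close>. The difference of the two sums collects the
  colourings with \<open>u\<close> coloured 0, where \<open>v\<close> has \<open>q\<close> colours
  of weight 1 left; the sum with weight 0 at \<open>u\<close> collects the others, where the colours
  left for \<open>v\<close> weigh \<open>\<tau> v + q - 1\<close> in total.\<close>

lemma wsum_pendant:
  assumes "finite V" "u \<in> V" "v \<notin> V" "\<forall>e\<in>E. e \<subseteq> V"
  shows "wsum q \<tau> (insert v V) (insert {u, v} E) =
    of_nat q * (wsum q \<tau> V E - wsum q (\<tau>(u := 0)) V E)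
      + (\<tau> v + of_nat q - 1) * wsum q (\<tau>(u := 0)) V E"
proof -
  let ?w = "\<lambda>\<tau> \<kappa>. \<Prod>v\<in>V. weight \<tau> v (\<kappa> v)"
  have "wsum q \<tau> (insert v V) (insert {u, v} E) =
      (\<Sum>\<kappa>\<in>colorings q V E. ?w \<tau> \<kappa> * (\<Sum>i\<in>{..q} - \<kappa> ` {u}. weight \<tau> v i))"
    using wsum_insert_vertex[of V v "{u}" E q \<tau>] assms by simp
  also have "\<dots> = (\<Sum>\<kappa>\<in>colorings q V E. of_nat q * (?w \<tau> \<kappa> - ?w (\<tau>(u := 0)) \<kappa>)
      + (\<tau> v + of_nat q - 1) * ?w (\<tau>(u := 0)) \<kappa>)"
  proof (rule sum.cong[OF refl])
    fix \<kappa> assume "\<kappa> \<in> colorings q V E"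
    then have k: "\<kappa> u \<le> q" using assms by (auto simp: colorings_def PiE_iff)
    have w: "?w \<tau> \<kappa> = weight \<tau> u (\<kappa> u) * (\<Prod>v\<in>V - {u}. weight \<tau> v (\<kappa> v))"
      using assms by (simp add: prod.remove)
    show "?w \<tau> \<kappa> * (\<Sum>i\<in>{..q} - \<kappa> ` {u}. weight \<tau> v i) =
      of_nat q * (?w \<tau> \<kappa> - ?w (\<tau>(u := 0)) \<kappa>) + (\<tau> v + of_nat q - 1) * ?w (\<tau>(u := 0)) \<kappa>"
      using k assms by (simp add: w prod_weight_upd sum_weight_remove) (simp add: weight_def)
  qed
  finally show ?thesis
    by (simp add: wsum_def sum.distrib sum_subtractf sum_distrib_left right_diff_distrib)
qed

text \<open>Deletion--contraction for the edge \<open>{u, z}\<close>; a contracted vertex carries the product of the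
  two weights.\<close>

lemma wsum_contract:
  assumes "finite V" "u \<in> V" "w \<in> V" "u \<noteq> w" "z \<notin> V" "\<forall>e\<in>E. e \<subseteq> V"
  shows "wsum q \<tau> (insert z V) (insert {u, z} (insert {w, z} E)) =
    wsum q \<tau> (insert z V) (insert {w, z} E) - wsum q (\<tau>(u := \<tau> u * \<tau> z)) V (insert {w, u} E)"
proof -
  let ?w = "\<lambda>\<tau> \<kappa>. \<Prod>v\<in>V. weight \<tau> v (\<kappa> v)"
  let ?\<sigma> = "\<tau>(u := \<tau> u * \<tau> z)"
  have 1: "wsum q \<tau> (insert z V) (insert {w, z} E) =
      (\<Sum>\<kappa>\<in>colorings q V E. ?w \<tau> \<kappa> * (\<Sum>i\<in>{..q} - \<kappa> ` {w}. weight \<tau> z i))"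
    using wsum_insert_vertex[of V z "{w}" E q \<tau>] assms by simp
  have 2: "wsum q \<tau> (insert z V) (insert {u, z} (insert {w, z} E)) =
      (\<Sum>\<kappa>\<in>colorings q V E. ?w \<tau> \<kappa> * (\<Sum>i\<in>{..q} - \<kappa> ` {u, w}. weight \<tau> z i))"
    using wsum_insert_vertex[of V z "{u, w}" E q \<tau>] assms by simp
  have sub: "colorings q V (insert {w, u} E) = {\<kappa> \<in> colorings q V E. \<kappa> w \<noteq> \<kappa> u}"
    using assms by (auto simp: colorings_def doubleton_eq_iff)
  have 3: "wsum q ?\<sigma> V (insert {w, u} E) =
      (\<Sum>\<kappa>\<in>colorings q V E. if \<kappa> w \<noteq> \<kappa> u then ?w ?\<sigma> \<kappa> else 0)"
    unfolding wsum_def sub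
    by (rule sum.inter_filter) (simp add: finite_colorings assms)
  show ?thesis unfolding 1 2 3 sum_subtractf[symmetric]
  proof (rule sum.cong[OF refl])
    fix \<kappa> assume "\<kappa> \<in> colorings q V E"
    then have k: "\<kappa> u \<le> q" "\<kappa> w \<le> q" using assms by (auto simp: colorings_def PiE_iff)
    have w: "?w \<tau> \<kappa> = weight \<tau> u (\<kappa> u) * (\<Prod>v\<in>V - {u}. weight \<tau> v (\<kappa> v))"
      using assms by (simp add: prod.remove)
    have s: "(\<Sum>i\<in>{..q} - {\<kappa> u, \<kappa> w}. weight \<tau> z i) = \<tau> z + of_nat q - weight \<tau> z (\<kappa> w) - weight \<tau> z (\<kappa> u)"
      if "\<kappa> u \<noteq> \<kappa> w"
    proof -
      have "{..q} - {\<kappa> u, \<kappa> w} = ({..q} - {\<kappa> w}) - {\<kappa> u}" by auto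
      then show ?thesis using k that by (simp add: sum_diff1 sum_weight_atMost)
    qed
    \<comment> \<open>If \<open>u\<close> and \<open>w\<close> share a colour, both sums over
      \<open>i\<close> agree. Otherwise they differ by the weight at \<open>z\<close> of the colour
      of \<open>u\<close>, and \<open>?\<sigma>\<close> absorbs this weight at
      \<open>u\<close>.\<close>
    show "?w \<tau> \<kappa> * (\<Sum>i\<in>{..q} - \<kappa> ` {u, w}. weight \<tau> z i) =
      ?w \<tau> \<kappa> * (\<Sum>i\<in>{..q} - \<kappa> ` {w}. weight \<tau> z i) - (if \<kappa> w \<noteq> \<kappa> u then ?w ?\<sigma> \<kappa> else 0)"
    proof (cases "\<kappa> u = \<kappa> w")
      case False
      then show ?thesis using k assms 
        by (simp add: s sum_weight_remove prod_weight_upd w) (auto simp: weight_def algebra_simps)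
    qed simp
  qed
qed

lemma wsum_single: "wsum q \<tau> {v} {} = \<tau> v + of_nat q"
  using wsum_insert_vertex[of "{}" v "{}" "{}" q \<tau>]
  by (simp add: colorings_def sum_weight_atMost)

section \<open>Linear coefficients of paths and cycles\<close>

text \<open>The vanishing constant term is carried along so that a further factor \<open>q\<close>
  pushes a term out of the linear coefficient.\<close>

definition has_linear :: "'v set \<Rightarrow> 'v set set \<Rightarrow> ('v \<Rightarrow> rat) \<Rightarrow> rat \<Rightarrow> bool" where
  "has_linear V E \<tau> b \<longleftrightarrow> (\<exists>p. (\<forall>q. poly p (of_nat q) = wsum q \<tau> V E) \<and>
     Polynomial.coeff p 0 = 0 \<and> Polynomial.coeff p 1 = b)"

text \<open>In \<open>wsum_pendant\<close> every term with a factor \<open>q\<close> has linear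
  coefficient 0; what remains is \<open>\<tau> v - 1\<close> times the sum with weight 0 at
  \<open>u\<close>.\<close>

lemma has_linear_pendant:
  assumes "has_linear V E \<tau> b'" "has_linear V E (\<tau>(u := 0)) b"
    and "finite V" "u \<in> V" "v \<notin> V" "\<forall>e\<in>E. e \<subseteq> V"
  shows "has_linear (insert v V) (insert {u, v} E) \<tau> ((\<tau> v - 1) * b)"
proof -
  obtain p where p: "\<And>q. poly p (of_nat q) = wsum q \<tau> V E"
    "Polynomial.coeff p 0 = 0" "Polynomial.coeff p 1 = b'"
    using assms(1) by (auto simp: has_linear_def)
  obtain p0 where p0: "\<And>q. poly p0 (of_nat q) = wsum q (\<tau>(u := 0)) V E"
    "Polynomial.coeff p0 0 = 0" "Polynomial.coeff p0 1 = b"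
    using assms(2) by (auto simp: has_linear_def)
  let ?p = "pCons 0 (p - p0) + smult (\<tau> v - 1) p0 + pCons 0 p0"
  have "poly ?p (of_nat q) = wsum q \<tau> (insert v V) (insert {u, v} E)" for q
    using assms(3-6) by (simp add: wsum_pendant p p0 algebra_simps)
  moreover have "Polynomial.coeff ?p 0 = 0" "Polynomial.coeff ?p 1 = (\<tau> v - 1) * b"
    using p p0 by simp_all
  ultimately show ?thesis unfolding has_linear_def by blast
qed

lemma has_linear_edge:
  assumes "u \<noteq> v"
  shows "has_linear {v, u} {{u, v}} \<tau> (\<tau> v + \<tau> u - 1)"
proof -
  have "wsum q \<tau> {v, u} {{u, v}} = poly [:0, \<tau> v + \<tau> u - 1, 1:] (of_nat q)" for q
    using wsum_pendant[of "{u}" u v "{}" q \<tau>] assms by (simp add: wsum_single algebra_simps)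
  then show ?thesis unfolding has_linear_def
    by (intro exI[of _ "[:0, \<tau> v + \<tau> u - 1, 1:]"]) simp
qed

fun path_edges :: "'v list \<Rightarrow> 'v set set" where
  "path_edges (x # y # zs) = insert {x, y} (path_edges (y # zs))"
| "path_edges _ = {}"

lemma path_edges_subset: "e \<in> path_edges vs \<Longrightarrow> e \<subseteq> set vs"
  by (induction vs rule: path_edges.induct) auto

lemma path_edges_snoc: "vs \<noteq> [] \<Longrightarrow> path_edges (vs @ [z]) = insert {last vs, z} (path_edges vs)"
  by (induction vs rule: path_edges.induct) auto

text \<open>Removing the end \<open>x\<close> leaves a path whose new end \<open>y\<close> has
  weight 0 and contributes 0 - 1. An edge with one weight 0 has coefficient
  \<open>\<tau> z - 1\<close>, so the sign only starts with the second inner vertex.\<close>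

lemma has_linear_path:
  assumes "distinct (x # y # zs)"
  shows "has_linear (set (x # y # zs)) (path_edges (x # y # zs)) \<tau>
    (if zs = [] then \<tau> x + \<tau> y - 1 else (- 1) ^ (length zs - 1) * (\<tau> x - 1) * (\<tau> (last zs) - 1))"
  using assms
proof (induction zs arbitrary: x y \<tau>)
  case Nil
  then show ?case using has_linear_edge[of y x \<tau>] by (simp add: insert_commute)
next
  case (Cons z zs)
  have d: "distinct (y # z # zs)" using Cons.prems by simp
  have "has_linear (insert x (set (y # z # zs))) (insert {y, x} (path_edges (y # z # zs))) \<tau>
    ((\<tau> x - 1) * (if zs = [] then (\<tau>(y := 0)) y + (\<tau>(y := 0)) z - 1
      else (- 1) ^ (length zs - 1) * ((\<tau>(y := 0)) y - 1) * ((\<tau>(y := 0)) (last zs) - 1)))"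
    by (rule has_linear_pendant[OF Cons.IH[OF d] Cons.IH[OF d]])
      (use Cons.prems in \<open>auto simp del: path_edges.simps dest!: path_edges_subset\<close>)
  moreover have "last zs \<noteq> y" if "zs \<noteq> []" using that Cons.prems by auto
  ultimately show ?case
    using d by (cases zs) (auto simp: insert_commute algebra_simps)
qed

definition cycle_edges :: "'v list \<Rightarrow> 'v set set" where
  "cycle_edges vs = insert {hd vs, last vs} (path_edges vs)"

text \<open>Deletion--contraction of the closing edge at the last vertex gives a path and a shorter
  cycle. The bound 2 admits the degenerate cycle, a single edge, as the base of the
  induction.\<close>

lemma has_linear_cycle:
  assumes "distinct vs" "length vs \<ge> 2"
  shows "has_linear (set vs) (cycle_edges vs) \<tau>
    ((- 1) ^ (length vs - 1) * (of_nat (length vs) - 1 - sum \<tau> (set vs)))"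
  using assms
proof (induction vs arbitrary: \<tau> rule: rev_induct)
  case Nil
  then show ?case by simp
next
  case (snoc z vs)
  show ?case
  proof (cases "length vs \<ge> 2")
    case False
    then obtain x where "vs = [x]" using snoc.prems by (cases vs) (auto simp: Suc_le_eq)
    then show ?thesis using has_linear_edge[of x z \<tau>] snoc.prems
      by (simp add: cycle_edges_def insert_commute algebra_simps)
  next
    case True
    then obtain x y zs where vs: "vs = x # y # zs"
      by (metis Suc_le_length_iff numeral_2_eq_2)
    let ?\<sigma> = "\<tau>(x := \<tau> x * \<tau> z)"
    let ?m = "of_nat (length vs) :: rat"
    obtain p where p: "\<And>q. poly p (of_nat q) = wsum q ?\<sigma> (set vs) (cycle_edges vs)"
      "Polynomial.coeff p 0 = 0"
      "Polynomial.coeff p 1 = (- 1) ^ (length vs - 1) * (?m - 1 - sum ?\<sigma> (set vs))"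
      using snoc.IH[of ?\<sigma>] snoc.prems True unfolding has_linear_def by auto
    obtain p' where p': "\<And>q. poly p' (of_nat q) = wsum q \<tau> (set (vs @ [z])) (path_edges (vs @ [z]))"
      "Polynomial.coeff p' 0 = 0"
      "Polynomial.coeff p' 1 = (- 1) ^ length zs * (\<tau> x - 1) * (\<tau> z - 1)"
      using has_linear_path[of x y "zs @ [z]" \<tau>] snoc.prems
      by (auto simp: has_linear_def vs simp del: path_edges.simps)
    have "hd vs \<noteq> last vs" using snoc.prems by (auto simp: vs)
    then have "wsum q \<tau> (insert z (set vs)) (insert {x, z} (insert {last vs, z} (path_edges vs))) =
       wsum q \<tau> (insert z (set vs)) (insert {last vs, z} (path_edges vs))
       - wsum q ?\<sigma> (set vs) (insert {last vs, x} (path_edges vs))" for q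
      using snoc.prems
      by (intro wsum_contract) (auto simp: vs simp del: path_edges.simps dest!: path_edges_subset)
    moreover have "path_edges (vs @ [z]) = insert {last vs, z} (path_edges vs)"
      by (rule path_edges_snoc) (simp add: vs)
    moreover from this have "cycle_edges (vs @ [z]) = insert {x, z} (insert {last vs, z} (path_edges vs))"
      by (simp add: cycle_edges_def) (simp add: vs)
    moreover have "cycle_edges vs = insert {last vs, x} (path_edges vs)"
      by (simp add: cycle_edges_def vs insert_commute del: path_edges.simps)
    ultimately have "poly (p' - p) (of_nat q) = wsum q \<tau> (set (vs @ [z])) (cycle_edges (vs @ [z]))" for q
      by (simp add: p p')
    moreover have "Polynomial.coeff (p' - p) 0 = 0" using p p' by simp
    \<comment> \<open>The product \<open>\<tau> x * \<tau> z\<close> arising from the path cancels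
      against the weight of the contracted vertex, so the formula stays linear in the
      weights.\<close>
    moreover have "Polynomial.coeff (p' - p) 1 =
      (- 1) ^ (length (vs @ [z]) - 1) * (of_nat (length (vs @ [z])) - 1 - sum \<tau> (set (vs @ [z])))"
    proof -
      have x: "x \<in> set vs" by (simp add: vs)
      have "(\<Sum>v\<in>set vs - {x}. ?\<sigma> v) = (\<Sum>v\<in>set vs - {x}. \<tau> v)"
        by (intro sum.cong) auto
      then have s: "sum ?\<sigma> (set vs) = sum \<tau> (set vs) - \<tau> x + \<tau> x * \<tau> z"
        using x by (simp add: sum.remove)
      have l: "length vs = Suc (Suc (length zs))" by (simp add: vs)
      show ?thesis
        using snoc.prems by (simp add: p p' s del: One_nat_def fun_upd_apply) (simp add: l algebra_simps)
    qed
    ultimately show ?thesis unfolding has_linear_def by blast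
  qed
qed

section \<open>Unicyclic graphs grow from their cycle by pendant vertices\<close>

lemma path_edges_conv_nth: "path_edges vs = (\<lambda>i. {vs ! i, vs ! Suc i}) ` {i. Suc i < length vs}"
proof (induction vs rule: path_edges.induct)
  case (1 x y zs)
  have "{i. Suc i < length (x # y # zs)} = insert 0 (Suc ` {i. Suc i < length (y # zs)})"
    by (auto simp: image_iff) (metis Suc_less_eq not0_implies_Suc)
  then show ?case using 1 by (simp add: image_image)
qed auto

text \<open>The index \<open>length vs - 1\<close> gives the closing edge and the smaller ones the
  path. This links the indexed form of \<open>is_cycle\<close> to the recursive form suited to
  induction.\<close>

lemma cycle_edges_conv_nth:
  assumes "vs \<noteq> []"
  shows "cycle_edges vs = (\<lambda>i. {vs ! i, vs ! (Suc i mod length vs)}) ` {..<length vs}"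
proof -
  have "{..<length vs} = insert (length vs - 1) {i. Suc i < length vs}"
    using assms by auto
  moreover have "(\<lambda>i. {vs ! i, vs ! (Suc i mod length vs)}) ` {i. Suc i < length vs} = path_edges vs"
    unfolding path_edges_conv_nth by (rule image_cong) auto
  ultimately show ?thesis
    using assms by (simp add: cycle_edges_def last_conv_nth hd_conv_nth insert_commute)
qed

lemma is_cycle_conv_cycle_edges:
  "is_cycle E C \<longleftrightarrow> C \<subseteq> E \<and> (\<exists>vs. distinct vs \<and> length vs \<ge> 3 \<and> C = cycle_edges vs)"
proof -
  have "(C = (\<lambda>i. {vs ! i, vs ! (Suc i mod length vs)}) ` {..<length vs}) = (C = cycle_edges vs)"
    if "length vs \<ge> 3" for vs
    using that by (subst cycle_edges_conv_nth) auto
  then show ?thesis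
    unfolding is_cycle_def by (intro arg_cong2[of _ _ _ _ "(\<and>)"] ex_cong1 conj_cong refl) simp
qed

lemma Union_cycle_edges:
  assumes "length vs \<ge> 3"
  shows "\<Union>(cycle_edges vs) = set vs"
proof
  have "vs \<noteq> []" using assms by auto
  then show "\<Union>(cycle_edges vs) \<subseteq> set vs"
    by (auto simp: cycle_edges_def dest: path_edges_subset)
  show "set vs \<subseteq> \<Union>(cycle_edges vs)"
    using \<open>vs \<noteq> []\<close> by (auto simp: cycle_edges_conv_nth in_set_conv_nth)
qed

lemma Suc_mod_less: "i < n \<Longrightarrow> Suc i mod n = (if Suc i = n then 0 else Suc i)"
  by simp

text \<open>Two different indices with the same edge would be cyclic successors of each other, which
  happens only for length 2.\<close>

lemma inj_on_cycle_edges: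
  assumes "distinct vs" "length vs \<ge> 3"
  shows "inj_on (\<lambda>i. {vs ! i, vs ! (Suc i mod length vs)}) {..<length vs}"
proof (rule inj_onI)
  fix i j assume ij: "i \<in> {..<length vs}" "j \<in> {..<length vs}"
    and "{vs ! i, vs ! (Suc i mod length vs)} = {vs ! j, vs ! (Suc j mod length vs)}"
  moreover have "Suc i mod length vs < length vs" "Suc j mod length vs < length vs"
    using assms by (auto intro!: mod_less_divisor)
  ultimately have "i = j \<or> i = Suc j mod length vs \<and> j = Suc i mod length vs"
    using assms(1) by (auto simp: doubleton_eq_iff nth_eq_iff_index_eq)
  then show "i = j"
  proof
    assume a: "i = Suc j mod length vs \<and> j = Suc i mod length vs"
    have "Suc j = length vs \<and> i = 0 \<or> i = Suc j"
      using trans[OF conjunct1[OF a] Suc_mod_less] ij(2) unfolding lessThan_iff by presburger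
    moreover have "Suc i = length vs \<and> j = 0 \<or> j = Suc i"
      using trans[OF conjunct2[OF a] Suc_mod_less] ij(1) unfolding lessThan_iff by presburger
    ultimately show "i = j" using assms(2) by linarith
  qed
qed

lemma card_cycle_edges:
  assumes "distinct vs" "length vs \<ge> 3"
  shows "card (cycle_edges vs) = length vs"
proof -
  have "vs \<noteq> []" using assms by auto
  then show ?thesis
    using card_image[OF inj_on_cycle_edges[OF assms]] by (simp add: cycle_edges_conv_nth)
qed

lemma card_cycle_edge:
  assumes "distinct vs" "length vs \<ge> 3" "e \<in> cycle_edges vs"
  shows "card e = 2"
proof -
  have "vs \<noteq> []" using assms by auto
  then obtain i where i: "i < length vs" "e = {vs ! i, vs ! (Suc i mod length vs)}"
    using assms(3) by (auto simp: cycle_edges_conv_nth)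
  have "i \<noteq> Suc i mod length vs" using assms(2) by (simp add: Suc_mod_less[OF i(1)])
  moreover have "Suc i mod length vs < length vs" using assms(2) by (auto intro!: mod_less_divisor)
  ultimately have "vs ! i \<noteq> vs ! (Suc i mod length vs)"
    using assms(1) i(1) by (simp add: nth_eq_iff_index_eq)
  then show ?thesis by (simp add: i(2))
qed

lemma finite_cycle_edges: "finite (cycle_edges vs)"
proof -
  have "cycle_edges vs \<subseteq> insert {hd vs, last vs} (Pow (set vs))"
    by (auto simp: cycle_edges_def dest: path_edges_subset)
  then show ?thesis by (rule finite_subset) simp
qed

lemma degree_cycle_edges:
  assumes "distinct vs" "length vs \<ge> 3" "v \<in> set vs"
  shows "degree (cycle_edges vs) v \<ge> 2"
proof -
  let ?f = "\<lambda>i. {vs ! i, vs ! (Suc i mod length vs)}"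
  have ne: "vs \<noteq> []" using assms by auto
  obtain i where i: "i < length vs" "v = vs ! i" using assms(3) by (auto simp: in_set_conv_nth)
  \<comment> \<open>The cyclic predecessor of \<open>i\<close>; its edge is the second one at
    \<open>v\<close>.\<close>
  define j where "j = (if i = 0 then length vs - 1 else i - 1)"
  have j: "j < length vs" "Suc j mod length vs = i" "i \<noteq> j"
    using i(1) assms(2) by (auto simp: j_def)
  have "?f i \<noteq> ?f j"
    using inj_onD[OF inj_on_cycle_edges[OF assms(1,2)], of i j] i(1) j(1,3) by blast
  then have "2 = card {?f i, ?f j}" by simp
  also have "\<dots> \<le> card {e \<in> cycle_edges vs. v \<in> e}"
    using i j ne by (intro card_mono) (auto simp: finite_cycle_edges cycle_edges_conv_nth)
  finally show ?thesis by (simp add: degree_def)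
qed

section \<open>Graphs grown from a cycle, their degrees and leaves\<close>

abbreviation adj :: "'v set set \<Rightarrow> 'v rel" where
  "adj E \<equiv> {(x, y). {x, y} \<in> E}"

text \<open>The attached trees are built one pendant vertex at a time, matching the recursion for
  the linear coefficient. That \<open>C\<close> really is a cycle is supplied separately as
  \<open>is_cycle C C\<close>.\<close>

inductive grown :: "'v set set \<Rightarrow> 'v set \<Rightarrow> 'v set set \<Rightarrow> bool" for C where
  base: "grown C (\<Union>C) C"
| pendant: "grown C V E \<Longrightarrow> u \<in> V \<Longrightarrow> v \<notin> V \<Longrightarrow> grown C (insert v V) (insert {u, v} E)"

lemma degree_insert:
  "finite E \<Longrightarrow> e \<notin> E \<Longrightarrow> degree (insert e E) v = degree E v + (if v \<in> e then 1 else 0)"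
proof -
  assume "finite E" "e \<notin> E"
  moreover have "{e' \<in> insert e E. v \<in> e'} = (if v \<in> e then insert e {e' \<in> E. v \<in> e'} else {e' \<in> E. v \<in> e'})"
    by auto
  ultimately show ?thesis by (simp add: degree_def)
qed

lemma degree_eq_0: "\<forall>e\<in>E. e \<subseteq> V \<Longrightarrow> v \<notin> V \<Longrightarrow> degree E v = 0"
  by (metis (mono_tags, lifting) card.empty degree_def empty_Collect_eq subsetD)

lemma grown_simple:
  assumes "grown C V E" "is_cycle C C"
  shows "finite V" "finite E" "\<forall>e\<in>E. e \<subseteq> V \<and> card e = 2" "C \<subseteq> E" "card E = card V"
proof -
  have "finite V \<and> finite E \<and> (\<forall>e\<in>E. e \<subseteq> V \<and> card e = 2) \<and> C \<subseteq> E \<and> card E = card V"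
    using assms(1)
  proof induction
    case base
    obtain vs where "distinct vs" "length vs \<ge> 3" "C = cycle_edges vs"
      using assms(2) by (auto simp: is_cycle_conv_cycle_edges)
    then show ?case
      using Union_cycle_edges[of vs] card_cycle_edges[of vs] card_cycle_edge[of vs]
      by (auto simp: finite_cycle_edges distinct_card)
  next
    case (pendant V E u v)
    then have "{u, v} \<notin> E" "u \<noteq> v" by auto
    then show ?case using pendant by auto
  qed
  then show "finite V" "finite E" "\<forall>e\<in>E. e \<subseteq> V \<and> card e = 2" "C \<subseteq> E" "card E = card V" by auto
qed

lemma grown_degree_insert:
  assumes "grown C V E" "is_cycle C C" "u \<in> V" "v \<notin> V"
  shows "degree (insert {u, v} E) w = degree E w + (if w = u \<or> w = v then 1 else 0)"
proof -
  have "{u, v} \<notin> E" using grown_simple(3)[OF assms(1,2)] assms(4) by auto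
  then show ?thesis using degree_insert[OF grown_simple(2)[OF assms(1,2)]] by auto
qed

text \<open>The last conclusion says that no edge joins two leaves; it makes the map from leaves to
  their edges injective.\<close>

lemma grown_degree:
  assumes "grown C V E" "is_cycle C C"
  shows "\<forall>v\<in>V. degree E v \<ge> 1" "\<forall>v\<in>\<Union>C. degree E v \<ge> 2" "\<forall>e\<in>E. \<exists>w\<in>e. degree E w \<ge> 2"
proof -
  have "(\<forall>v\<in>V. degree E v \<ge> 1) \<and> (\<forall>v\<in>\<Union>C. degree E v \<ge> 2) \<and> (\<forall>e\<in>E. \<exists>w\<in>e. degree E w \<ge> 2)"
    using assms(1)
  proof induction
    case base
    obtain vs where vs: "distinct vs" "length vs \<ge> 3" "C = cycle_edges vs"
      using assms(2) by (auto simp: is_cycle_conv_cycle_edges)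
    have d: "\<forall>v\<in>\<Union>C. degree C v \<ge> 2"
      using degree_cycle_edges[OF vs(1,2)] Union_cycle_edges[OF vs(2)] by (simp add: vs(3))
    moreover have "e \<noteq> {}" if "e \<in> C" for e
      using card_cycle_edge[OF vs(1,2), of e] that by (auto simp: vs(3))
    ultimately show ?case
      by (metis UnionI ex_in_conv le_trans one_le_numeral)
  next
    case (pendant V E u v)
    note deg = grown_degree_insert[OF pendant.hyps(1) assms(2) pendant.hyps(2,3)]
    have 2: "\<forall>w\<in>\<Union>C. degree E w \<ge> 2" and 3: "\<forall>e\<in>E. \<exists>w\<in>e. degree E w \<ge> 2"
      and 1: "\<forall>w\<in>V. degree E w \<ge> 1" using pendant.IH by auto
    show ?case
    proof (intro conjI ballI)
      show "degree (insert {u, v} E) w \<ge> 1" if "w \<in> insert v V" for w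
        using that 1 by (auto simp: deg)
      show "degree (insert {u, v} E) w \<ge> 2" if "w \<in> \<Union>C" for w
        using bspec[OF 2 that] by (simp add: deg)
      show "\<exists>w\<in>e. degree (insert {u, v} E) w \<ge> 2" if "e \<in> insert {u, v} E" for e
      proof (cases "e = {u, v}")
        case True
        then show ?thesis using 1 pendant.hyps by (intro bexI[of _ u]) (auto simp: deg)
      next
        case False
        with that have "e \<in> E" by blast
        then obtain w where "w \<in> e" "degree E w \<ge> 2" using 3 by blast
        then show ?thesis by (intro bexI[of _ w]) (auto simp: deg)
      qed
    qed
  qed
  then show "\<forall>v\<in>V. degree E v \<ge> 1" "\<forall>v\<in>\<Union>C. degree E v \<ge> 2" "\<forall>e\<in>E. \<exists>w\<in>e. degree E w \<ge> 2"
    by auto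
qed

definition leaves :: "'v set \<Rightarrow> 'v set set \<Rightarrow> 'v set" where
  "leaves V E = {v \<in> V. degree E v = 1}"

text \<open>Sending a leaf to its only edge is a bijection onto the edges that are not internal, and
  a grown graph has as many edges as vertices.\<close>

lemma card_internal_edges:
  assumes "grown C V E" "is_cycle C C"
  shows "card (internal_edges E) + card (leaves V E) = card V"
proof -
  note simple = grown_simple[OF assms] and deg = grown_degree[OF assms]
  have "\<forall>v\<in>leaves V E. \<exists>e. {e \<in> E. v \<in> e} = {e}"
    by (auto simp: leaves_def degree_def card_1_singleton_iff)
  then obtain g where g: "\<And>v. v \<in> leaves V E \<Longrightarrow> {e \<in> E. v \<in> e} = {g v}"
    by metis
  have "inj_on g (leaves V E)"
  proof (rule inj_onI, rule ccontr)
    fix v w assume vw: "v \<in> leaves V E" "w \<in> leaves V E" "g v = g w" "v \<noteq> w"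
    have e: "g v \<in> E" "v \<in> g v" "w \<in> g v" using g[OF vw(1)] g[OF vw(2)] vw(3) by auto
    then have "card (g v) = 2" using simple(3) by auto
    then have "g v = {v, w}" using e vw(4) by (auto simp: card_2_iff)
    then show False using deg(3) e vw by (auto simp: leaves_def)
  qed
  moreover have "g ` leaves V E = E - internal_edges E"
  proof
    show "g ` leaves V E \<subseteq> E - internal_edges E"
    proof clarify
      fix v assume v: "v \<in> leaves V E"
      then have "g v \<in> E" "v \<in> g v" using g by auto
      then show "g v \<in> E - internal_edges E"
        using v by (auto simp: internal_edges_def leaves_def intro!: bexI[of _ v])
    qed
    show "E - internal_edges E \<subseteq> g ` leaves V E"
    proof
      fix e assume e: "e \<in> E - internal_edges E"
      then obtain v where v: "v \<in> e" "\<not> degree E v \<ge> 2" by (auto simp: internal_edges_def)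
      then have "v \<in> leaves V E" using deg(1) simple(3) e by (force simp: leaves_def)
      then show "e \<in> g ` leaves V E" using g[of v] v e by auto
    qed
  qed
  ultimately have "card (leaves V E) = card (E - internal_edges E)" by (metis card_image)
  moreover have sub: "internal_edges E \<subseteq> E" by (auto simp: internal_edges_def)
  moreover have "card (internal_edges E) \<le> card E" by (rule card_mono[OF simple(2) sub])
  ultimately show ?thesis
    using simple by (simp add: card_Diff_subset finite_subset)
qed

section \<open>Trivial trees and the linear coefficient of a grown graph\<close>

text \<open>The roots of the trivial trees: cycle vertices to which nothing was attached, so that
  the recursion never resets their weight to 0.\<close>

definition bare :: "'v set set \<Rightarrow> 'v set set \<Rightarrow> 'v set" where
  "bare E C = {v \<in> \<Union>C. \<forall>e\<in>E - C. v \<notin> e}"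

lemma nontrivial_roots_eq:
  assumes "finite E" "\<forall>e\<in>E. card e = 2"
  shows "nontrivial_roots E C = \<Union>C - bare E C"
proof -
  have "card (component (E - C) v) > 1 \<longleftrightarrow> (\<exists>e\<in>E - C. v \<in> e)" for v
  proof
    assume "card (component (E - C) v) > 1"
    moreover have "card {v} = 1" by simp
    ultimately have "\<not> component (E - C) v \<subseteq> {v}" by (metis card_mono finite.emptyI finite_insert leD)
    then obtain w where "(v, w) \<in> (adj (E - C))\<^sup>*" "v \<noteq> w"
      by (auto simp: component_def)
    then obtain y where "{v, y} \<in> E - C" by (auto elim: converse_rtranclE)
    then show "\<exists>e\<in>E - C. v \<in> e" by blast
  next
    assume "\<exists>e\<in>E - C. v \<in> e"
    then obtain e where e: "e \<in> E - C" "v \<in> e" by auto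
    then obtain x y where "e = {x, y}" "x \<noteq> y"
      using assms(2) by (auto simp: card_2_iff)
    with e(2) obtain w where w: "e = {v, w}" "v \<noteq> w"
      by (cases "v = x") auto
    have "(v, v) \<in> (adj (E - C))\<^sup>*" "(v, w) \<in> (adj (E - C))\<^sup>*"
      using e w by (auto intro: r_into_rtrancl)
    then have sub: "{v, w} \<subseteq> component (E - C) v" by (simp add: component_def)
    \<comment> \<open>An infinite set has \<open>card\<close> 0, so the lower bound on the
      cardinality requires the component to be finite.\<close>
    have "component (E - C) v \<subseteq> insert v (\<Union>E)"
    proof
      fix x assume "x \<in> component (E - C) v"
      then have "(v, x) \<in> (adj (E - C))\<^sup>*" by (simp add: component_def)
      then show "x \<in> insert v (\<Union>E)" by (cases rule: rtranclE; blast)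
    qed
    moreover have "finite e" if "e \<in> E" for e using that assms(2) by (metis card.infinite zero_neq_numeral)
    ultimately have "finite (component (E - C) v)"
      using assms(1) by (meson finite_Union finite_insert finite_subset)
    then have "card {v, w} \<le> card (component (E - C) v)" using sub by (rule card_mono)
    then show "card (component (E - C) v) > 1" using w(2) by simp
  qed
  then show ?thesis by (auto simp: nontrivial_roots_def bare_def)
qed

text \<open>The vertex added last is always a leaf, and \<open>bare\<close> only shrinks; the first
  pendant vertex must be attached to the cycle and makes it shrink properly.\<close>

lemma grown_trivial_or_leaf:
  assumes "grown C V E" "is_cycle C C"
  shows "bare E C = \<Union>C \<and> leaves V E = {} \<or> bare E C \<noteq> \<Union>C \<and> leaves V E \<noteq> {}"
proof -
  have "E = C \<and> V = \<Union>C \<or> bare E C \<noteq> \<Union>C \<and> leaves V E \<noteq> {}"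
    using assms(1)
  proof induction
    case base
    then show ?case by simp
  next
    case (pendant V E u v)
    note simple = grown_simple[OF pendant.hyps(1) assms(2)]
    have new: "{u, v} \<notin> E" using simple(3) pendant.hyps by auto
    have "degree E v = 0" by (rule degree_eq_0[of E V]) (use simple pendant.hyps in auto)
    then have "v \<in> leaves (insert v V) (insert {u, v} E)"
      by (simp add: leaves_def grown_degree_insert[OF pendant.hyps(1) assms(2) pendant.hyps(2,3)])
    moreover have "bare (insert {u, v} E) C \<noteq> \<Union>C"
    proof (cases "E = C")
      case True
      moreover have "bare C C = \<Union>C" by (auto simp: bare_def)
      ultimately have "u \<in> \<Union>C" using pendant by auto
      moreover have "u \<notin> bare (insert {u, v} E) C" using new True by (auto simp: bare_def)
      ultimately show ?thesis by metis
    next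
      case False
      then have "bare E C \<noteq> \<Union>C" using pendant.IH by simp
      moreover have "bare (insert {u, v} E) C \<subseteq> bare E C" "bare E C \<subseteq> \<Union>C"
        by (auto simp: bare_def)
      ultimately show ?thesis by (metis subset_antisym)
    qed
    ultimately show ?case by (intro disjI2 conjI) auto
  qed
  moreover have "bare C C = \<Union>C" by (auto simp: bare_def)
  moreover have "leaves (\<Union>C) C = {}"
    using grown_degree(2)[OF grown.base assms(2)] by (force simp: leaves_def)
  ultimately show ?thesis by auto
qed

text \<open>Attaching \<open>v\<close> to \<open>u\<close> gives a factor
  \<open>\<tau> v - 1\<close> and resets the weight of \<open>u\<close> to 0. Off the cycle, a
  vertex that stays a leaf keeps its factor, while one that receives a neighbour ends with -1; on
  the cycle, a vertex that receives a neighbour drops out of the sum of weights.\<close>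

lemma grown_has_linear:
  assumes "grown C V E" "is_cycle C C"
  shows "has_linear V E \<tau> ((- 1) ^ (card (\<Union>C) - 1) * (of_nat (card (\<Union>C)) - 1 - sum \<tau> (bare E C))
    * (\<Prod>v\<in>V - \<Union>C. if v \<in> leaves V E then \<tau> v - 1 else - 1))"
  using assms(1)
proof (induction arbitrary: \<tau>)
  case base
  obtain vs where vs: "distinct vs" "length vs \<ge> 3" "C = cycle_edges vs"
    using assms(2) by (auto simp: is_cycle_conv_cycle_edges)
  have "bare C C = \<Union>C" by (auto simp: bare_def)
  then show ?case
    using has_linear_cycle[OF vs(1), of \<tau>] vs(2) Union_cycle_edges[OF vs(2)] distinct_card[OF vs(1)]
    by (simp add: vs(3))
next
  case (pendant V E u v)
  note simple = grown_simple[OF pendant.hyps(1) assms(2)]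
    and deg = grown_degree_insert[OF pendant.hyps(1) assms(2) pendant.hyps(2,3)]
  let ?E = "insert {u, v} E" and ?V = "insert v V" and ?\<sigma> = "\<tau>(u := 0)"
  have UC: "\<Union>C \<subseteq> V" using simple(3,4) by blast
  have new: "{u, v} \<notin> C" "v \<notin> \<Union>C" "u \<noteq> v" using simple(3,4) pendant.hyps UC by auto
  have "degree E v = 0" by (rule degree_eq_0[of E V]) (use simple pendant.hyps in auto)
  then have v: "v \<in> leaves ?V ?E" by (simp add: leaves_def deg)
  have u: "u \<notin> leaves ?V ?E" 
    using grown_degree(1)[OF pendant.hyps(1) assms(2)] pendant.hyps(2) by (force simp: leaves_def deg)
  have other: "w \<in> leaves ?V ?E \<longleftrightarrow> w \<in> leaves V E" if "w \<noteq> u" "w \<noteq> v" for w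
    using that by (auto simp: leaves_def deg)
  have "bare ?E C = bare E C - {u}" using new by (auto simp: bare_def)
  moreover have "finite (bare E C)"
    by (rule finite_subset[of _ V]) (use UC simple in \<open>auto simp: bare_def\<close>)
  moreover have "sum ?\<sigma> (bare E C - {u}) = sum \<tau> (bare E C - {u})" by (rule sum.cong) auto
  ultimately have s: "sum ?\<sigma> (bare E C) = sum \<tau> (bare ?E C)"
    by (cases "u \<in> bare E C") (simp_all add: sum.remove)
  \<comment> \<open>Only \<open>u\<close> can change status: if it was a leaf off the cycle, its
    reset weight turns the factor into -1, as required for a non-leaf.\<close>
  have "(\<Prod>w\<in>V - \<Union>C. if w \<in> leaves V E then ?\<sigma> w - 1 else - 1) =
     (\<Prod>w\<in>V - \<Union>C. if w \<in> leaves ?V ?E then \<tau> w - 1 else - 1)"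
  proof (rule prod.cong[OF refl])
    fix w assume "w \<in> V - \<Union>C"
    then have "w \<noteq> v" using pendant.hyps by auto
    then show "(if w \<in> leaves V E then ?\<sigma> w - 1 else - 1) =
        (if w \<in> leaves ?V ?E then \<tau> w - 1 else - 1)"
      using u other[of w] by auto
  qed
  moreover have "?V - \<Union>C = insert v (V - \<Union>C)" using new by auto
  ultimately have p: "(\<Prod>w\<in>?V - \<Union>C. if w \<in> leaves ?V ?E then \<tau> w - 1 else - 1) =
     (\<tau> v - 1) * (\<Prod>w\<in>V - \<Union>C. if w \<in> leaves V E then ?\<sigma> w - 1 else - 1)"
    using v pendant.hyps simple by simp
  have "has_linear ?V ?E \<tau> ((\<tau> v - 1) * ((- 1) ^ (card (\<Union>C) - 1)
     * (of_nat (card (\<Union>C)) - 1 - sum ?\<sigma> (bare E C))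
     * (\<Prod>w\<in>V - \<Union>C. if w \<in> leaves V E then ?\<sigma> w - 1 else - 1)))"
    by (rule has_linear_pendant[OF pendant.IH pendant.IH])
      (use simple pendant.hyps in auto)
  then show ?case unfolding p s by (simp only: mult_ac)
qed

section \<open>Connected unicyclic graphs are grown\<close>

lemma path_edges_append: "path_edges us \<subseteq> path_edges (us @ ws)"
  by (induction us rule: path_edges.induct) auto

text \<open>A walk is followed step by step; when it returns to a vertex of the path built so far,
  the path is cut back to that vertex.\<close>

lemma simple_path:
  assumes "(x, y) \<in> (adj F)\<^sup>*"
  obtains vs where "vs \<noteq> []" "distinct vs" "hd vs = x" "last vs = y" "path_edges vs \<subseteq> F"
proof -
  have "\<exists>vs. vs \<noteq> [] \<and> distinct vs \<and> hd vs = x \<and> last vs = y \<and> path_edges vs \<subseteq> F"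
    using assms
  proof (induction rule: rtrancl_induct)
    case base
    show ?case by (rule exI[of _ "[x]"]) simp
  next
    case (step y z)
    then obtain vs where vs: "vs \<noteq> []" "distinct vs" "hd vs = x" "last vs = y" "path_edges vs \<subseteq> F"
      by blast
    show ?case
    proof (cases "z \<in> set vs")
      case True
      then obtain us ws where uw: "vs = (us @ [z]) @ ws" by (auto dest: split_list)
      then have "path_edges (us @ [z]) \<subseteq> F" using vs(5) path_edges_append[of "us @ [z]" ws] by simp
      then show ?thesis
        using vs by (intro exI[of _ "us @ [z]"]) (auto simp: uw hd_append split: if_splits)
    next
      case False
      then show ?thesis
        using vs step.hyps by (intro exI[of _ "vs @ [z]"]) (simp add: path_edges_snoc)
    qed
  qed
  then show ?thesis using that by blast
qed

lemma sym_adjacency: "sym (adj F)"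
  by (auto simp: sym_def insert_commute)

lemma rtrancl_adjacency_mono:
  "(x, y) \<in> (adj F)\<^sup>* \<Longrightarrow> F \<subseteq> F' \<Longrightarrow> (x, y) \<in> (adj F')\<^sup>*"
  by (erule rev_subsetD) (rule rtrancl_mono, auto)

lemma path_edges_connected:
  "v \<in> set vs \<Longrightarrow> (hd vs, v) \<in> (adj (path_edges vs))\<^sup>*"
proof (induction vs rule: path_edges.induct)
  case (1 x y zs)
  show ?case
  proof (cases "v = x")
    case False
    then have "(y, v) \<in> (adj (path_edges (y # zs)))\<^sup>*" using 1 by simp
    then have "(y, v) \<in> (adj (path_edges (x # y # zs)))\<^sup>*"
      by (rule rtrancl_adjacency_mono) auto
    moreover have "(x, y) \<in> adj (path_edges (x # y # zs))" by simp
    ultimately show ?thesis unfolding list.sel by (blast intro: converse_rtrancl_into_rtrancl)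
  qed simp
qed auto

lemma grown_connected:
  assumes "grown C V E" "is_cycle C C"
  shows "\<exists>x\<in>V. \<forall>y\<in>V. (x, y) \<in> (adj E)\<^sup>*"
  using assms(1)
proof induction
  case base
  obtain vs where vs: "distinct vs" "length vs \<ge> 3" "C = cycle_edges vs"
    using assms(2) by (auto simp: is_cycle_conv_cycle_edges)
  have "(hd vs, v) \<in> (adj C)\<^sup>*" if "v \<in> set vs" for v
    by (rule rtrancl_adjacency_mono[OF path_edges_connected[OF that]]) (auto simp: vs(3) cycle_edges_def)
  moreover have "hd vs \<in> set vs" using vs(2) by (intro hd_in_set) auto
  ultimately show ?case using Union_cycle_edges[OF vs(2)] by (auto simp: vs(3))
next
  case (pendant V E u v)
  then obtain x where x: "x \<in> V" "\<And>y. y \<in> V \<Longrightarrow> (x, y) \<in> (adj E)\<^sup>*" by blast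
  have "(x, y) \<in> (adj (insert {u, v} E))\<^sup>*" if "y \<in> V" for y
    using x(2)[OF that] by (rule rtrancl_adjacency_mono) auto
  moreover from this[OF pendant.hyps(2)] have "(x, v) \<in> (adj (insert {u, v} E))\<^sup>*"
    by (rule rtrancl_into_rtrancl) simp
  ultimately show ?case using x(1) by blast
qed

text \<open>Every vertex has positive degree, so the edges determine the vertices. A maximal grown
  subgraph can thus be chosen by its edge set alone.\<close>

lemma grown_vertices:
  assumes "grown C V E" "is_cycle C C"
  shows "V = \<Union>E"
proof
  show "V \<subseteq> \<Union>E"
  proof
    fix v assume "v \<in> V"
    then have "degree E v \<noteq> 0" using grown_degree(1)[OF assms] by force
    then have "{e \<in> E. v \<in> e} \<noteq> {}" unfolding degree_def by (metis card.empty)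
    then show "v \<in> \<Union>E" by auto
  qed
  show "\<Union>E \<subseteq> V" using grown_simple(3)[OF assms] by auto
qed

text \<open>A maximal grown subgraph spans the graph by connectedness, and an edge outside of it would
  close a second cycle.\<close>

lemma unicyclic_imp_grown:
  assumes "simple_graph V E" "connected_graph V E" "is_cycle E C"
    and unique: "\<And>D. is_cycle E D \<Longrightarrow> D = C"
  shows "grown C V E"
proof -
  have C: "is_cycle C C" and CE: "C \<subseteq> E" using assms(3) by (auto simp: is_cycle_def)
  have "finite V" "\<forall>e\<in>E. e \<subseteq> V \<and> card e = 2" using assms(1) by (auto simp: simple_graph_def)
  then have "finite E" by (intro finite_subset[of E "Pow V"]) auto
  let ?A = "{F. F \<subseteq> E \<and> (\<exists>W. grown C W F)}"
  have "finite ?A" using \<open>finite E\<close> by (intro finite_subset[of ?A "Pow E"]) auto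
  moreover have "C \<in> ?A" using CE grown.base by auto
  ultimately have "\<exists>F\<in>?A. \<forall>F'\<in>?A. F \<subseteq> F' \<longrightarrow> F = F'"
    by (intro finite_has_maximal) (metis empty_iff)+
  then obtain F where F: "F \<in> ?A" and max: "\<forall>F'\<in>?A. F \<subseteq> F' \<longrightarrow> F = F'"
    by (rule bexE)
  then obtain W where W: "grown C W F" and FE: "F \<subseteq> E" by auto
  have WF: "W = \<Union>F" by (rule grown_vertices[OF W C])
  have WV: "W \<subseteq> V" using WF FE \<open>\<forall>e\<in>E. e \<subseteq> V \<and> card e = 2\<close> by blast
  obtain x where x: "x \<in> W" "\<And>y. y \<in> W \<Longrightarrow> (x, y) \<in> (adj F)\<^sup>*"
    using grown_connected[OF W C] by auto
  have "y \<in> W" if "y \<in> V" for y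
  proof -
    have "(x, y) \<in> (adj E)\<^sup>*"
      using assms(2) x(1) WV that by (auto simp: connected_graph_def component_def)
    then show ?thesis
    proof (induction rule: rtrancl_induct)
      case (step u v)
      \<comment> \<open>Otherwise the edge from \<open>u\<close> to \<open>v\<close> would attach a
        pendant vertex to \<open>F\<close>, against maximality.\<close>
      show "v \<in> W"
      proof (rule ccontr)
        assume "v \<notin> W"
        then have "insert {u, v} F \<in> ?A" using W step FE grown.pendant[OF W] by auto
        then have "F = insert {u, v} F" by (rule max[rule_format]) (rule subset_insertI)
        then show False using WF \<open>v \<notin> W\<close> by blast
      qed
    qed (rule x(1))
  qed
  then have VW: "V = W" using WV by auto
  have "E \<subseteq> F"
  proof (rule ccontr)
    assume "\<not> E \<subseteq> F"
    then obtain e where e: "e \<in> E" "e \<notin> F" by auto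
    then obtain u v where uv: "e = {u, v}" "u \<noteq> v"
      using \<open>\<forall>e\<in>E. e \<subseteq> V \<and> card e = 2\<close> by (auto simp: card_2_iff)
    have "u \<in> W" "v \<in> W" using e uv \<open>\<forall>e\<in>E. e \<subseteq> V \<and> card e = 2\<close> VW by auto
    then have "(u, v) \<in> (adj F)\<^sup>*"
      using x(2) sym_rtrancl[OF sym_adjacency[of F]] by (meson rtrancl_trans symD)
    then obtain vs where vs: "vs \<noteq> []" "distinct vs" "hd vs = u" "last vs = v" "path_edges vs \<subseteq> F"
      by (rule simple_path)
    \<comment> \<open>One vertex would force \<open>u = v\<close>, and two would make the path the
      edge \<open>e\<close> itself, which is not in \<open>F\<close>.\<close>
    have "length vs \<ge> 3"
    proof (rule ccontr)
      assume "\<not> length vs \<ge> 3"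
      moreover obtain a ws where a: "vs = a # ws" using vs(1) by (cases vs) auto
      moreover obtain b zs where "ws = b # zs" using uv(2) vs(3,4) a by (cases ws) auto
      ultimately show False using vs e uv by (cases zs) auto
    qed
    moreover have vs_e: "cycle_edges vs = insert e (path_edges vs)" using vs uv by (simp add: cycle_edges_def)
    ultimately have "is_cycle E (cycle_edges vs)"
      using vs FE e unfolding is_cycle_conv_cycle_edges by auto
    \<comment> \<open>This cycle passes through \<open>e\<close>, whereas \<open>C\<close> lies
      inside \<open>F\<close>.\<close>
    then have "cycle_edges vs = C" by (rule unique)
    moreover have "C \<subseteq> F" by (rule grown_simple(4)[OF W C])
    ultimately show False using vs_e e by auto
  qed
  then show ?thesis using W FE VW by auto
qed

section \<open>Evaluation at \<open>x_0 = t\<close> and \<open>x_1 = \<dots> = x_q = 1\<close>\<close>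

definition monomials :: "nat \<Rightarrow> nat \<Rightarrow> nat multiset set" where
  "monomials n q = {M. size M = n \<and> set_mset M \<subseteq> {..q}}"

text \<open>Fixing the degree \<open>n\<close> makes the sum finite. On series homogeneous of degree
  \<open>n\<close> it is the whole evaluation, which is why homogeneity accompanies it.\<close>

definition ev :: "nat \<Rightarrow> nat \<Rightarrow> rat \<Rightarrow> rat series \<Rightarrow> rat" where
  "ev n q t f = (\<Sum>M\<in>monomials n q. coeff f M * t ^ count M 0)"

definition homogeneous :: "nat \<Rightarrow> rat series \<Rightarrow> bool" where
  "homogeneous n f \<longleftrightarrow> (\<forall>M. coeff f M \<noteq> 0 \<longrightarrow> size M = n)"

lemma finite_monomials: "finite (monomials n q)"
proof (rule finite_subset)
  show "finite {A. A \<subseteq># (\<Sum>i\<in>{..q}. replicate_mset n i)}" by (rule finite_submultisets)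
  show "monomials n q \<subseteq> {A. A \<subseteq># (\<Sum>i\<in>{..q}. replicate_mset n i)}"
  proof
    fix M assume M: "M \<in> monomials n q"
    have "count M i \<le> count (\<Sum>i\<in>{..q}. replicate_mset n i) i" for i
    proof (cases "i \<in># M")
      case True
      then have "i \<le> q" using M by (auto simp: monomials_def)
      then show ?thesis using M count_le_size[of M i] by (simp add: monomials_def count_sum)
    qed (simp add: not_in_iff)
    then show "M \<in> {A. A \<subseteq># (\<Sum>i\<in>{..q}. replicate_mset n i)}" by (simp add: subseteq_mset_def)
  qed
qed

lemma ev_sum_scale: "ev n q t (\<Sum>l\<in>S. scale (a l) (F l)) = (\<Sum>l\<in>S. a l * ev n q t (F l))"
proof (induction S rule: infinite_finite_induct)
  case (insert x S)
  then show ?case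
    by (simp add: ev_def plus_series.rep_eq scale.rep_eq distrib_right sum.distrib sum_distrib_left mult.assoc)
qed (simp_all add: ev_def zero_series.rep_eq)

lemma homogeneous_mult:
  assumes "homogeneous m f" "homogeneous n g"
  shows "homogeneous (m + n) (f * g)"
  unfolding homogeneous_def
proof (intro allI impI)
  fix M assume "coeff (f * g) M \<noteq> 0"
  then obtain A B where "A + B = M" "coeff f A * coeff g B \<noteq> 0"
    unfolding times_series.rep_eq by (elim sum.not_neutral_contains_not_neutral) auto
  then show "size M = m + n" using assms by (auto simp: homogeneous_def)
qed

text \<open>Pairs of monomials are grouped by their product. Homogeneity ensures that a splitting
  with nonzero coefficients has factors of degrees exactly \<open>m\<close> and
  \<open>n\<close>.\<close>

lemma ev_mult:
  assumes "homogeneous m f" "homogeneous n g"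
  shows "ev (m + n) q t (f * g) = ev m q t f * ev n q t g"
proof -
  let ?P = "monomials m q \<times> monomials n q"
  let ?h = "\<lambda>p. coeff f (fst p) * coeff g (snd p) * t ^ count (fst p + snd p) 0"
  have "ev m q t f * ev n q t g = (\<Sum>p\<in>?P. ?h p)"
    unfolding ev_def sum_product sum.cartesian_product
    by (rule sum.cong) (auto simp: power_add)
  also have "\<dots> = (\<Sum>M\<in>monomials (m + n) q. \<Sum>p\<in>{p \<in> ?P. fst p + snd p = M}. ?h p)"
    by (rule sum.group[symmetric, OF finite_cartesian_product[OF finite_monomials finite_monomials] finite_monomials])
      (auto simp: monomials_def)
  also have "\<dots> = ev (m + n) q t (f * g)"
    unfolding ev_def
  proof (rule sum.cong[OF refl])
    fix M assume M: "M \<in> monomials (m + n) q"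
    have "(\<Sum>p\<in>{p \<in> ?P. fst p + snd p = M}. ?h p) = (\<Sum>p\<in>{(A, B). A + B = M}. ?h p)"
    proof (rule sum.mono_neutral_left)
      show "\<forall>p\<in>{(A, B). A + B = M} - {p \<in> ?P. fst p + snd p = M}. ?h p = 0"
        using assms M by (fastforce simp: homogeneous_def monomials_def)
    qed (auto simp: finite_splits)
    then show "(\<Sum>p\<in>{p \<in> ?P. fst p + snd p = M}. ?h p) = coeff (f * g) M * t ^ count M 0"
      by (simp add: times_series.rep_eq sum_distrib_right case_prod_beta)
  qed
  finally show ?thesis by simp
qed

lemma homogeneous_one: "homogeneous 0 1"
  by (simp add: homogeneous_def one_series.rep_eq)

lemma ev_one: "ev 0 q t 1 = 1"
proof -
  have "monomials 0 q = {{#}}" by (auto simp: monomials_def)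
  then show ?thesis by (simp add: ev_def one_series.rep_eq)
qed

section \<open>Evaluating chromatic symmetric functions and stars\<close>

lemma coeff_chromatic:
  "coeff (chromatic_symmetric_function V E) M =
    of_nat (card {\<kappa> \<in> proper_colorings V E. image_mset \<kappa> (mset_set V) = M})"
  by (simp add: chromatic_symmetric_function_def Series_inverse)

lemma homogeneous_chromatic: "homogeneous (card V) (chromatic_symmetric_function V E)"
  unfolding homogeneous_def
proof (intro allI impI)
  fix M assume "coeff (chromatic_symmetric_function V E) M \<noteq> 0"
  then have "{\<kappa> \<in> proper_colorings V E. image_mset \<kappa> (mset_set V) = M} \<noteq> {}"
    unfolding coeff_chromatic by (metis card.empty of_nat_0)
  then show "size M = card V" by auto
qed

lemma prod_weight_const:
  "finite V \<Longrightarrow> (\<Prod>v\<in>V. weight (\<lambda>_. t) v (\<kappa> v)) = t ^ count (image_mset \<kappa> (mset_set V)) 0"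
  by (induction V rule: finite_induct) (simp_all add: weight_def)

text \<open>Colourings are grouped by their monomial; a monomial in the first \<open>q + 1\<close>
  variables forces all colours to be at most \<open>q\<close>.\<close>

lemma ev_chromatic:
  assumes "finite V"
  shows "ev (card V) q t (chromatic_symmetric_function V E) = wsum q (\<lambda>_. t) V E"
proof -
  let ?m = "\<lambda>\<kappa>. image_mset \<kappa> (mset_set V)"
  have "wsum q (\<lambda>_. t) V E = (\<Sum>\<kappa>\<in>colorings q V E. t ^ count (?m \<kappa>) 0)"
    unfolding wsum_def by (simp add: prod_weight_const assms)
  also have "\<dots> = (\<Sum>M\<in>monomials (card V) q. \<Sum>\<kappa>\<in>{\<kappa> \<in> colorings q V E. ?m \<kappa> = M}. t ^ count (?m \<kappa>) 0)"
    by (rule sum.group[symmetric, OF finite_colorings[OF assms] finite_monomials])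
      (use assms in \<open>auto simp: monomials_def colorings_def PiE_iff\<close>)
  also have "\<dots> = ev (card V) q t (chromatic_symmetric_function V E)"
    unfolding ev_def
  proof (rule sum.cong[OF refl])
    fix M assume M: "M \<in> monomials (card V) q"
    have "{\<kappa> \<in> colorings q V E. ?m \<kappa> = M} = {\<kappa> \<in> proper_colorings V E. ?m \<kappa> = M}"
      using M assms by (auto simp: colorings_def proper_colorings_def PiE_iff monomials_def image_subset_iff)
    then show "(\<Sum>\<kappa>\<in>{\<kappa> \<in> colorings q V E. ?m \<kappa> = M}. t ^ count (?m \<kappa>) 0) =
       coeff (chromatic_symmetric_function V E) M * t ^ count M 0"
      by (simp add: coeff_chromatic)
  qed
  finally show ?thesis by simp
qed

text \<open>The first term comes from the centre having colour 0, the second from its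
  \<open>q\<close> other colours.\<close>

lemma wsum_star:
  "wsum q \<tau> {..<Suc k} (star_edges (Suc k)) = \<tau> 0 * of_nat q ^ k + of_nat q * (\<Prod>i\<in>{1..k}. \<tau> i + of_nat q - 1)"
proof (induction k arbitrary: \<tau>)
  case 0
  have "{..<Suc 0} = {0}" by auto
  then show ?case using wsum_single[of q \<tau> "0::nat"] by (simp add: star_edges_def)
next
  case (Suc k)
  have "star_edges (Suc (Suc k)) = insert {0, Suc k} (star_edges (Suc k))"
    by (auto simp: star_edges_def less_Suc_eq image_iff)
  moreover have "{..<Suc (Suc k)} = insert (Suc k) {..<Suc k}" by auto
  moreover have "\<forall>e\<in>star_edges (Suc k). e \<subseteq> {..<Suc k}" by (auto simp: star_edges_def)
  ultimately have "wsum q \<tau> {..<Suc (Suc k)} (star_edges (Suc (Suc k))) =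
     of_nat q * (wsum q \<tau> {..<Suc k} (star_edges (Suc k)) - wsum q (\<tau>(0 := 0)) {..<Suc k} (star_edges (Suc k)))
     + (\<tau> (Suc k) + of_nat q - 1) * wsum q (\<tau>(0 := 0)) {..<Suc k} (star_edges (Suc k))"
    using wsum_pendant[of "{..<Suc k}" 0 "Suc k" "star_edges (Suc k)" q \<tau>] by simp
  moreover have "(\<Prod>i\<in>{1..k}. (\<tau>(0 := 0)) i + of_nat q - 1) = (\<Prod>i\<in>{1..k}. \<tau> i + of_nat q - 1)"
    by (rule prod.cong) auto
  ultimately show ?case by (simp add: Suc.IH algebra_simps)
qed

text \<open>\<open>wsum_star\<close> at constant weight \<open>t\<close>, read as a polynomial in
  \<open>q\<close>; the exponent \<open>k - 1\<close> is the number of leaves.\<close>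

definition star_poly :: "rat \<Rightarrow> nat \<Rightarrow> rat poly" where
  "star_poly t k = smult t ([:0, 1:] ^ (k - 1)) + [:0, 1:] * [:t - 1, 1:] ^ (k - 1)"

lemma homogeneous_st: "homogeneous k (st k)"
  using homogeneous_chromatic[of "{..<k}"] by (simp add: st_def)

lemma ev_st:
  assumes "k > 0"
  shows "ev k q t (st k) = poly (star_poly t k) (of_nat q)"
proof -
  obtain j where "k = Suc j" using assms gr0_conv_Suc by blast
  then show ?thesis
    using ev_chromatic[of "{..<k}" q t "star_edges k"]
    by (simp add: st_def star_poly_def wsum_star algebra_simps)
qed

lemma ev_st_partition:
  assumes "0 \<notin># l"
  shows "homogeneous (sum_mset l) (st_partition l)"
    and "ev (sum_mset l) q t (st_partition l) = poly (\<Prod>k\<in>#l. star_poly t k) (of_nat q)"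
proof -
  have "homogeneous (sum_mset l) (st_partition l) \<and>
    ev (sum_mset l) q t (st_partition l) = poly (\<Prod>k\<in>#l. star_poly t k) (of_nat q)"
    using assms
  proof (induction l)
    case empty
    show ?case by (simp add: st_partition_def homogeneous_one ev_one)
  next
    case (add k l)
    have IH: "homogeneous (sum_mset l) (st_partition l)"
      "ev (sum_mset l) q t (st_partition l) = poly (\<Prod>k\<in>#l. star_poly t k) (of_nat q)"
      using add by auto
    have s: "st_partition (add_mset k l) = st k * st_partition l" by (simp add: st_partition_def)
    show ?case
      using homogeneous_mult[OF homogeneous_st IH(1)] ev_mult[OF homogeneous_st IH(1)] IH(2) add.prems
      by (simp add: s ev_st)
  qed
  then show "homogeneous (sum_mset l) (st_partition l)"
    and "ev (sum_mset l) q t (st_partition l) = poly (\<Prod>k\<in>#l. star_poly t k) (of_nat q)" by auto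
qed

section \<open>Comparing coefficients\<close>

abbreviation pc :: "'a::zero poly \<Rightarrow> nat \<Rightarrow> 'a" where "pc \<equiv> Polynomial.coeff"

lemma coeff_mult_1: "pc (p * q) 1 = pc p 0 * pc q 1 + pc p 1 * pc q 0"
  for p q :: "'a::comm_semiring_0 poly"
  by (simp add: coeff_mult)

lemma coeff_star_poly_0: "k > 0 \<Longrightarrow> pc (star_poly t k) 0 = (if k = 1 then t else 0)"
  by (cases k) (auto simp: star_poly_def coeff_0_power)

text \<open>The term \<open>t * q ^ (k - 1)\<close> is linear in \<open>q\<close> exactly when
  \<open>k = 2\<close>; this is the source of the correction for the hook with
  \<open>m = n - 2\<close>.\<close>

lemma coeff_star_poly_1:
  assumes "k \<ge> 2"
  shows "pc (star_poly t k) 1 = (t - 1) ^ (k - 1) + (if k = 2 then t else 0)"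
proof -
  obtain j where j: "k = Suc (Suc j)" using assms by (metis Suc_le_D numeral_2_eq_2 Suc_le_mono)
  show ?thesis by (cases j) (simp_all add: j star_poly_def coeff_0_power)
qed

lemma coeff_prod_star_poly_hook:
  assumes "m + 2 \<le> n"
  shows "pc (\<Prod>k\<in>#hook n m. star_poly t k) 0 = 0"
    and "pc (\<Prod>k\<in>#hook n m. star_poly t k) 1 = t ^ m * ((t - 1) ^ (n - m - 1) + (if n = m + 2 then t else 0))"
proof -
  have "star_poly t 1 = [:t, 1:]" by (simp add: star_poly_def)
  then have h: "(\<Prod>k\<in>#hook n m. star_poly t k) = star_poly t (n - m) * [:t, 1:] ^ m"
    by (simp add: hook_def)
  have 0: "pc (star_poly t (n - m)) 0 = 0" using assms by (subst coeff_star_poly_0) auto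
  have 1: "pc (star_poly t (n - m)) 1 = (t - 1) ^ (n - m - 1) + (if n = m + 2 then t else 0)"
    using assms by (subst coeff_star_poly_1) auto
  show "pc (\<Prod>k\<in>#hook n m. star_poly t k) 0 = 0"
    by (simp add: h 0 coeff_mult_0)
  show "pc (\<Prod>k\<in>#hook n m. star_poly t k) 1 = t ^ m * ((t - 1) ^ (n - m - 1) + (if n = m + 2 then t else 0))"
    unfolding h coeff_mult_1 0 1 by (simp add: coeff_0_power)
qed

lemma coeff_prod_star_poly_ones:
  assumes "n > 0"
  shows "pc (\<Prod>k\<in>#hook n (n - 1). star_poly t k) 0 = t ^ n"
proof -
  obtain m where "n = Suc m" using assms gr0_conv_Suc by blast
  moreover have "star_poly t 1 = [:t, 1:]" by (simp add: star_poly_def)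
  ultimately show ?thesis by (simp add: hook_def coeff_mult_0 coeff_0_power)
qed

text \<open>Each star with at least two vertices is divisible by \<open>q\<close>, so two of them
  give a factor \<open>q ^ 2\<close>.\<close>

lemma coeff_prod_star_poly_two_parts:
  assumes "i \<ge> 2" "j \<ge> 2"
  shows "pc (\<Prod>k\<in>#add_mset i (add_mset j l). star_poly t k) 0 = 0"
    and "pc (\<Prod>k\<in>#add_mset i (add_mset j l). star_poly t k) 1 = 0"
proof -
  have 0: "pc (star_poly t i) 0 = 0" "pc (star_poly t j) 0 = 0"
    using assms by (simp_all add: coeff_star_poly_0)
  have p: "(\<Prod>k\<in>#add_mset i (add_mset j l). star_poly t k) = star_poly t i * (star_poly t j * (\<Prod>k\<in>#l. star_poly t k))"
    by simp
  show "pc (\<Prod>k\<in>#add_mset i (add_mset j l). star_poly t k) 0 = 0"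
    unfolding p by (simp add: coeff_mult_0 0)
  show "pc (\<Prod>k\<in>#add_mset i (add_mset j l). star_poly t k) 1 = 0"
    unfolding p coeff_mult_1 0 coeff_mult_0 by simp
qed

section \<open>Hooks among the partitions\<close>

lemma replicate_mset_1_conv: "(\<forall>k\<in>#l. k = 1) \<Longrightarrow> l = replicate_mset (size l) (1::nat)"
  by (induction l) auto

lemma hook_in_partitions: "m < n \<Longrightarrow> hook n m \<in> partitions n"
  by (auto simp: partitions_def hook_def sum_mset_replicate_mset)

lemma inj_on_hook: "inj_on (hook n) A"
  by (rule inj_onI) (metis hook_def size_add_mset size_replicate_mset Suc_inject)

text \<open>Separate the parts equal to 1 from the larger ones; with at most one larger part the
  partition is a hook.\<close>

lemma non_hook_partition:
  assumes "l \<in> partitions n" "n > 0" "l \<notin> hook n ` {..<n}"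
  obtains i j l' where "l = add_mset i (add_mset j l')" "i \<ge> 2" "j \<ge> 2"
proof -
  have "0 \<notin># l" and sum: "sum_mset l = n" using assms(1) by (auto simp: partitions_def)
  then have pos: "\<forall>k\<in>#l. k > 0" by (metis gr0I)
  define B where "B = filter_mset (\<lambda>k. k \<ge> 2) l"
  define S where "S = filter_mset (\<lambda>k. \<not> k \<ge> 2) l"
  have B: "k \<ge> 2" if "k \<in># B" for k using that by (simp add: B_def)
  have "\<forall>k\<in>#S. k = 1" using pos by (force simp: S_def)
  then obtain s where S: "S = replicate_mset s 1" using replicate_mset_1_conv by blast
  have l: "l = B + replicate_mset s 1" unfolding S[symmetric] B_def S_def by (rule multiset_partition)
  consider "B = {#}" | i where "B = {#i#}" | i j B' where "B = add_mset i (add_mset j B')"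
    by (metis multiset_cases)
  then show ?thesis
  proof cases
    case 1
    then have "l = hook n (n - 1)"
      using l sum assms(2) by (cases n) (auto simp: hook_def sum_mset_replicate_mset)
    then show ?thesis using assms(2,3) by auto
  next
    case (2 i)
    then have "l = hook n s" "s < n"
      using l sum B[of i] by (auto simp: hook_def sum_mset_replicate_mset)
    then show ?thesis using assms(3) by blast
  next
    case (3 i j B')
    then show ?thesis using that[of i j "B' + replicate_mset s 1"] B[of i] B[of j] l by simp
  qed
qed

lemma sum_partitions_hooks:
  fixes F :: "nat multiset \<Rightarrow> rat"
  assumes "n > 0" "\<And>i j l. i \<ge> 2 \<Longrightarrow> j \<ge> 2 \<Longrightarrow> F (add_mset i (add_mset j l)) = 0"
  shows "(\<Sum>l\<in>partitions n. F l) = (\<Sum>m<n. F (hook n m))"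
proof -
  have "(\<Sum>l\<in>partitions n. F l) = (\<Sum>l\<in>hook n ` {..<n}. F l)"
  proof (rule sum.mono_neutral_right)
    show "\<forall>l\<in>partitions n - hook n ` {..<n}. F l = 0"
    proof
      fix l assume "l \<in> partitions n - hook n ` {..<n}"
      then obtain i j l' where "l = add_mset i (add_mset j l')" "i \<ge> 2" "j \<ge> 2"
        using non_hook_partition[of l n] assms(1) by auto
      then show "F l = 0" using assms(2) by simp
    qed
  qed (auto simp: finite_partitions hook_in_partitions)
  then show ?thesis by (simp add: sum.reindex inj_on_hook)
qed

section \<open>Hook coefficients and their generating polynomial\<close>

lemma poly_eq_on_nat:
  assumes "\<And>n::nat. poly p (of_nat n) = poly q (of_nat n)"
  shows "p = (q :: rat poly)"
proof -
  have "range of_nat \<subseteq> {x::rat. poly (p - q) x = 0}" using assms by auto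
  moreover have "infinite (range (of_nat :: nat \<Rightarrow> rat))"
    by (simp add: finite_image_iff inj_of_nat)
  ultimately have "infinite {x. poly (p - q) x = 0}" using finite_subset by blast
  then show ?thesis using poly_roots_finite[of "p - q"] by auto
qed

text \<open>Both sides of the star expansion become polynomials in \<open>q\<close> that agree at
  all naturals. The constant coefficient sees only the partition into ones, the linear coefficient
  only hooks.\<close>

lemma hook_coefficients:
  assumes "finite V" "n = card V" "n \<ge> 2"
    and star: "star_expansion (chromatic_symmetric_function V E) n a"
    and lin: "\<And>t. has_linear V E (\<lambda>_. t) (b t)"
  shows "a (hook n (n - 1)) = 0"
    and "b t = (\<Sum>m<n - 1. a (hook n m) * (t ^ m * ((t - 1) ^ (n - m - 1) + (if n = m + 2 then t else 0))))"
proof -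
  let ?Q = "\<lambda>t l. \<Prod>k\<in>#l. star_poly t k"
  have eq: "\<exists>p. p = (\<Sum>l\<in>partitions n. smult (a l) (?Q t l)) \<and> pc p 0 = 0 \<and> pc p 1 = b t" for t
  proof -
    obtain p where p: "\<And>q. poly p (of_nat q) = wsum q (\<lambda>_. t) V E" "pc p 0 = 0" "pc p 1 = b t"
      using lin[of t] by (auto simp: has_linear_def)
    have "p = (\<Sum>l\<in>partitions n. smult (a l) (?Q t l))"
    proof (rule poly_eq_on_nat)
      fix q :: nat
      have "poly p (of_nat q) = ev n q t (chromatic_symmetric_function V E)"
        using assms(1,2) p(1) by (simp add: ev_chromatic)
      also have "\<dots> = (\<Sum>l\<in>partitions n. a l * ev n q t (st_partition l))"
        using star by (simp add: star_expansion_def ev_sum_scale)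
      also have "\<dots> = (\<Sum>l\<in>partitions n. a l * poly (?Q t l) (of_nat q))"
        by (rule sum.cong) (auto simp: partitions_def ev_st_partition(2)[symmetric])
      finally show "poly p (of_nat q) = poly (\<Sum>l\<in>partitions n. smult (a l) (?Q t l)) (of_nat q)"
        by (simp add: poly_sum)
    qed
    then show ?thesis using p by auto
  qed
  have n: "n > 0" "{..<n} = insert (n - 1) {..<n - 1}" using assms(3) by auto
  have c0: "(\<Sum>m<n. a (hook n m) * pc (?Q t (hook n m)) 0) = 0" for t
  proof -
    have "(\<Sum>l\<in>partitions n. a l * pc (?Q t l) 0) = 0" using eq[of t] by (auto simp: coeff_sum)
    then show ?thesis
      by (subst (asm) sum_partitions_hooks[OF n(1)]) (use coeff_prod_star_poly_two_parts(1) in auto)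
  qed
  have c1: "(\<Sum>m<n. a (hook n m) * pc (?Q t (hook n m)) 1) = b t"
  proof -
    have "(\<Sum>l\<in>partitions n. a l * pc (?Q t l) 1) = b t" using eq[of t] by (auto simp: coeff_sum)
    then show ?thesis
      by (subst (asm) sum_partitions_hooks[OF n(1)])
        (use coeff_prod_star_poly_two_parts(2) in \<open>auto simp del: One_nat_def\<close>)
  qed
  \<comment> \<open>At \<open>t = 1\<close> the partition into ones has constant coefficient 1, and
    all other hooks have constant coefficient 0.\<close>
  have "(\<Sum>m<n - 1. a (hook n m) * pc (?Q 1 (hook n m)) 0) = 0"
    by (rule sum.neutral) (auto simp: coeff_prod_star_poly_hook(1))
  then show ones: "a (hook n (n - 1)) = 0"
    using c0[of 1] by (simp add: n(2) coeff_prod_star_poly_ones[OF n(1)] del: One_nat_def)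
  have "(\<Sum>m<n - 1. a (hook n m) * pc (?Q t (hook n m)) 1) =
    (\<Sum>m<n - 1. a (hook n m) * (t ^ m * ((t - 1) ^ (n - m - 1) + (if n = m + 2 then t else 0))))"
    by (rule sum.cong[OF refl], subst coeff_prod_star_poly_hook(2)) auto
  then show "b t = (\<Sum>m<n - 1. a (hook n m) * (t ^ m * ((t - 1) ^ (n - m - 1) + (if n = m + 2 then t else 0))))"
    using c1 by (simp add: n(2) ones del: One_nat_def)
qed

text \<open>The value 1 is excluded because \<open>(t - 1) / t\<close> never attains it.\<close>

lemma poly_eq_except_1:
  assumes "\<And>y. y \<noteq> 1 \<Longrightarrow> poly p y = poly q y"
  shows "p = (q :: rat poly)"
proof -
  have "UNIV - {1} \<subseteq> {x::rat. poly (p - q) x = 0}" using assms by auto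
  moreover have "infinite (UNIV - {1::rat})" by (simp add: infinite_UNIV_char_0)
  ultimately have "infinite {x. poly (p - q) x = 0}" using finite_subset by blast
  then show ?thesis using poly_roots_finite[of "p - q"] by auto
qed

text \<open>After division by \<open>t^(n - 1)\<close>, the substitution \<open>y = (t - 1) / t\<close> turns
  \<open>t^m (t - 1)^(n - 1 - m)\<close> into a power of \<open>y\<close>. Here \<open>A = c - 1\<close> and \<open>B = c - r\<close>.\<close>

lemma hook_sum_substitution:
  fixes b :: "rat \<Rightarrow> rat" and A B :: rat
  assumes "n \<ge> 2" "l + 2 \<le> n"
    and sum: "\<And>t. b t = (\<Sum>m<n - 1. h m * (t ^ m * ((t - 1) ^ (n - m - 1) + (if n = m + 2 then t else 0))))"
    and b: "\<And>t. b t = (- 1) ^ (n - 1 - l) * (t - 1) ^ l * (A - B * t)"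
  shows "[:h (n - 2):] + (\<Sum>m<n - 1. monom (h m) (n - m - 1)) =
    monom ((- 1) ^ (n - 1 - l)) l * ([:1, - 1:] ^ (n - 2 - l) * [:A - B, - A:])"
proof (rule poly_eq_except_1)
  fix y :: rat assume y: "y \<noteq> 1"
  define t where "t = inverse (1 - y)"
  have ne: "1 - y \<noteq> 0" using y by simp
  have t1: "(1 - y) * t = 1" and ty: "(1 - y) * (t - 1) = y"
    using ne by (simp_all add: t_def right_diff_distrib)
  have "(1 - y) ^ (n - 1) * b t = (\<Sum>m<n - 1. h m * y ^ (n - m - 1) + (if m = n - 2 then h m else 0))"
    unfolding sum sum_distrib_left
  proof (rule sum.cong[OF refl])
    fix m assume m: "m \<in> {..<n - 1}"
    then have "n - 1 = m + (n - m - 1)" by auto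
    then have e: "(1 - y) ^ (n - 1) = (1 - y) ^ m * (1 - y) ^ (n - m - 1)" by (metis power_add)
    have 1: "(1 - y) ^ (n - 1) * (t ^ m * (t - 1) ^ (n - m - 1)) = y ^ (n - m - 1)"
    proof -
      have "(1 - y) ^ (n - 1) * (t ^ m * (t - 1) ^ (n - m - 1)) =
        ((1 - y) * t) ^ m * ((1 - y) * (t - 1)) ^ (n - m - 1)"
        unfolding e power_mult_distrib by (simp only: mult_ac)
      then show ?thesis by (simp add: t1 ty)
    qed
    \<comment> \<open>The correction term becomes constant in \<open>y\<close>, which explains the
      summand \<open>[:h (n - 2):]\<close>.\<close>
    have 2: "(1 - y) ^ (n - 1) * (t ^ m * t) = 1" if "n = m + 2"
    proof -
      have "(1 - y) ^ (n - 1) * (t ^ m * t) = ((1 - y) * t) ^ (n - 1)"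
        using that by (simp add: power_mult_distrib mult_ac)
      then show ?thesis by (simp add: t1)
    qed
    show "(1 - y) ^ (n - 1) * (h m * (t ^ m * ((t - 1) ^ (n - m - 1) + (if n = m + 2 then t else 0)))) =
      h m * y ^ (n - m - 1) + (if m = n - 2 then h m else 0)"
    proof (cases "n = m + 2")
      case True
      have "(1 - y) ^ (n - 1) * (h m * (t ^ m * ((t - 1) ^ (n - m - 1) + t))) =
        h m * ((1 - y) ^ (n - 1) * (t ^ m * (t - 1) ^ (n - m - 1))) + h m * ((1 - y) ^ (n - 1) * (t ^ m * t))"
        by (simp only: distrib_left mult_ac)
      also have "\<dots> = h m * y ^ (n - m - 1) + h m" unfolding 1 2[OF True] by simp
      finally show ?thesis using True by simp
    next
      case False
      have "(1 - y) ^ (n - 1) * (h m * (t ^ m * (t - 1) ^ (n - m - 1))) =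
        h m * ((1 - y) ^ (n - 1) * (t ^ m * (t - 1) ^ (n - m - 1)))"
        by (simp only: mult_ac)
      then show ?thesis using False m unfolding 1 by auto
    qed
  qed
  also have "\<dots> = poly ([:h (n - 2):] + (\<Sum>m<n - 1. monom (h m) (n - m - 1))) y"
    using assms(1) by (simp add: sum.distrib poly_sum poly_monom)
  finally have L: "(1 - y) ^ (n - 1) * b t = poly ([:h (n - 2):] + (\<Sum>m<n - 1. monom (h m) (n - m - 1))) y" .
  \<comment> \<open>Of the \<open>n - 1\<close> factors \<open>1 - y\<close>, \<open>l\<close> go to
    the powers of \<open>t - 1\<close> and one to \<open>A - B * t\<close>; the rest remain.\<close>
  have n: "n - 1 = l + (n - 2 - l) + 1" using assms(2) by simp
  have "(1 - y) ^ (n - 1) * b t =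
    (- 1) ^ (n - 1 - l) * ((1 - y) ^ (l + (n - 2 - l) + 1) * ((t - 1) ^ l * (A - B * t)))"
    unfolding b by (subst (1) n) (simp only: mult_ac)
  also have "(1 - y) ^ (l + (n - 2 - l) + 1) * ((t - 1) ^ l * (A - B * t)) =
    ((1 - y) * (t - 1)) ^ l * (1 - y) ^ (n - 2 - l) * (A * (1 - y) - B * ((1 - y) * t))"
    unfolding power_add power_mult_distrib by (simp add: algebra_simps)
  also have "(- 1) ^ (n - 1 - l) * \<dots> =
    poly (monom ((- 1) ^ (n - 1 - l)) l * ([:1, - 1:] ^ (n - 2 - l) * [:A - B, - A:])) y"
    unfolding t1 ty by (simp add: poly_monom algebra_simps)
  finally show "poly ([:h (n - 2):] + (\<Sum>m<n - 1. monom (h m) (n - m - 1))) y =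
    poly (monom ((- 1) ^ (n - 1 - l)) l * ([:1, - 1:] ^ (n - 2 - l) * [:A - B, - A:])) y"
    using L by simp
qed

text \<open>The exponents \<open>n - m - 1\<close> run from 1 to \<open>n - 1\<close>, so the
  constant term comes from the correction alone; \<open>h (n - 2)\<close> is the coefficient of both
  \<open>y ^ 0\<close> and \<open>y ^ 1\<close>.\<close>

lemma coeff_hook_sum:
  fixes h :: "nat \<Rightarrow> rat"
  shows "j \<ge> 1 \<Longrightarrow> j < n \<Longrightarrow> pc ([:h (n - 2):] + (\<Sum>m<n - 1. monom (h m) (n - m - 1))) j = h (n - 1 - j)"
    and "pc ([:h (n - 2):] + (\<Sum>m<n - 1. monom (h m) (n - m - 1))) 0 = h (n - 2)"
proof -
  assume j: "j \<ge> 1" "j < n"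
  have "pc [:h (n - 2):] j = 0" using j by (cases j) auto
  then have "pc ([:h (n - 2):] + (\<Sum>m<n - 1. monom (h m) (n - m - 1))) j =
    (\<Sum>m<n - 1. pc (monom (h m) (n - m - 1)) j)"
    by (simp add: coeff_sum del: coeff_monom)
  also have "\<dots> = (\<Sum>m<n - 1. if m = n - 1 - j then h m else 0)"
    by (rule sum.cong) (use j in auto)
  also have "\<dots> = h (n - 1 - j)" using j by simp
  finally show "pc ([:h (n - 2):] + (\<Sum>m<n - 1. monom (h m) (n - m - 1))) j = h (n - 1 - j)" .
next
  show "pc ([:h (n - 2):] + (\<Sum>m<n - 1. monom (h m) (n - m - 1))) 0 = h (n - 2)"
    by (auto simp: coeff_sum intro!: sum.neutral)
qed

lemma grown_has_linear_const:
  assumes "grown C V E" "is_cycle C C"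
  defines "n \<equiv> card V" and "c \<equiv> card (\<Union>C)" and "l \<equiv> card (leaves V E)"
  shows "has_linear V E (\<lambda>_. t) ((- 1) ^ (n - 1 - l) * (t - 1) ^ l * (of_nat c - 1 - of_nat (card (bare E C)) * t))"
    and "c \<ge> 3" "l + c \<le> n"
proof -
  note simple = grown_simple[OF assms(1,2)]
  have UC: "\<Union>C \<subseteq> V" using simple(3,4) by blast
  have sub: "leaves V E \<subseteq> V - \<Union>C"
    using grown_degree(2)[OF assms(1,2)] by (fastforce simp: leaves_def)
  have card: "card (V - \<Union>C) = n - c" "c \<le> n"
    using UC simple(1) by (simp_all add: n_def c_def card_Diff_subset finite_subset card_mono)
  have "l \<le> n - c" using card_mono[OF _ sub] simple(1) card by (simp add: l_def)
  then show lc: "l + c \<le> n" using card by simp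
  obtain vs where "distinct vs" "length vs \<ge> 3" "C = cycle_edges vs"
    using assms(2) by (auto simp: is_cycle_conv_cycle_edges)
  then show c3: "c \<ge> 3" using Union_cycle_edges[of vs] by (simp add: c_def distinct_card)
  have "(\<Prod>v\<in>V - \<Union>C. if v \<in> leaves V E then t - 1 else - 1) =
     (\<Prod>v\<in>leaves V E. t - 1) * (\<Prod>v\<in>(V - \<Union>C) - leaves V E. - 1)"
    using sub simple(1) by (subst prod.If_cases) (auto simp: Int_absorb1 Diff_eq)
  also have "\<dots> = (t - 1) ^ l * (- 1) ^ (n - c - l)"
    using sub simple(1) card by (simp add: l_def card_Diff_subset finite_subset)
  finally have p: "(\<Prod>v\<in>V - \<Union>C. if v \<in> leaves V E then t - 1 else - 1) = (t - 1) ^ l * (- 1) ^ (n - c - l)" .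
  \<comment> \<open>The sign collects \<open>c - 1\<close> from the cycle and one for each of the
    \<open>n - c - l\<close> vertices off the cycle that are not leaves.\<close>
  have "n - 1 - l = (c - 1) + (n - c - l)" using lc c3 by simp
  then have s: "(- 1) ^ (n - 1 - l) = (- 1) ^ (c - 1) * (- 1 :: rat) ^ (n - c - l)" by (metis power_add)
  show "has_linear V E (\<lambda>_. t) ((- 1) ^ (n - 1 - l) * (t - 1) ^ l * (of_nat c - 1 - of_nat (card (bare E C)) * t))"
    using grown_has_linear[OF assms(1,2), of "\<lambda>_. t"]
    unfolding p s c_def[symmetric] by (simp add: mult_ac)
qed

section \<open>Reading off the longest hook\<close>

lemma longest_hook_unique:
  assumes "a (hook n m) \<noteq> 0" "m < n" "\<And>m'. m < m' \<Longrightarrow> m' < n \<Longrightarrow> a (hook n m') = 0"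
  shows "longest_hook n a m' \<longleftrightarrow> m' = m"
  using assms unfolding longest_hook_def by (metis le_less_linear le_antisym)

theorem proposition3p6:
  fixes V :: "'v set" and E C :: "'v set set"
    and n k r c :: nat and a :: "nat multiset \<Rightarrow> rat"
  assumes "simple_graph V E" and "connected_graph V E" and "unicyclic E"
    and "is_cycle E C"
    and "n = card V" and "k = card (internal_edges E)"
    and "r = card (nontrivial_roots E C)" and "c = card (\<Union>C)"
    and "star_expansion (chromatic_symmetric_function V E) n a"
  shows "(\<exists>m1. longest_hook n a m1) \<and>
    (\<forall>m1. longest_hook n a m1 \<longrightarrow>
      k = (if r = 0 \<or> r = 1 then m1 + 2 else m1 + 1) \<and>
      a (hook n m1) =
        (if r = 0 then (- 1) ^ (k - 2)
         else if r = 1 then (- 1) ^ (k - 2) * (of_nat c - 1)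
         else (- 1) ^ (k - 1) * (of_nat r - 1)))"
proof -
  have C: "is_cycle C C" using assms(4) by (auto simp: is_cycle_def)
  have G: "grown C V E"
    using assms(3) by (intro unicyclic_imp_grown assms(1,2,4)) (metis unicyclic_def assms(4))
  note simple = grown_simple[OF G C]
  define l where "l = card (leaves V E)"
  define z where "z = card (bare E C)"
  have kl: "k + l = n" using card_internal_edges[OF G C] assms(5,6) by (simp add: l_def)
  have c3: "c \<ge> 3" "l + c \<le> n"
    using grown_has_linear_const(2,3)[OF G C] by (simp_all add: assms(5,8) l_def)
  have sub: "bare E C \<subseteq> \<Union>C" by (auto simp: bare_def)
  have fin: "finite (\<Union>C)" using c3(1) assms(8) by (metis card.infinite not_numeral_le_zero)
  have "r = c - z" "z \<le> c"
    using nontrivial_roots_eq[OF simple(2), of C] simple(3) sub fin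
    by (simp_all add: assms(7,8) z_def card_Diff_subset finite_subset card_mono)
  then have zr: "of_nat c - 1 - of_nat z = (of_nat r - 1 :: rat)" by (simp add: of_nat_diff)
  have r0: "r = 0 \<longleftrightarrow> l = 0"
  proof -
    have "bare E C = \<Union>C \<longleftrightarrow> z = c"
      using sub fin unfolding z_def assms(8) by (metis card_subset_eq)
    moreover have "leaves V E = {} \<longleftrightarrow> l = 0"
      using simple(1) by (simp add: l_def leaves_def)
    ultimately show ?thesis
      using grown_trivial_or_leaf[OF G C] \<open>r = c - z\<close> \<open>z \<le> c\<close> by auto
  qed
  define b :: "rat \<Rightarrow> rat" where
    "b t = (- 1) ^ (n - 1 - l) * (t - 1) ^ l * ((of_nat c - 1) - of_nat z * t)" for t
  have lin: "has_linear V E (\<lambda>_. t) (b t)" for t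
    using grown_has_linear_const(1)[OF G C, of t] by (simp add: b_def l_def z_def assms(5,8))
  define h where "h m = a (hook n m)" for m
  have n2: "n \<ge> 2" "l + 2 \<le> n" using c3 by auto
  note hooks = hook_coefficients[OF simple(1) assms(5) n2(1) assms(9) lin]
  have last: "h (n - 1) = 0" using hooks(1) by (simp add: h_def)
  define s :: rat where "s = (- 1) ^ (n - 1 - l)"
  \<comment> \<open>The polynomial of \<open>hook_sum_substitution\<close> with its factor
    \<open>y ^ l\<close> and sign removed; its constant term \<open>A - B\<close> equals
    \<open>r - 1\<close>.\<close>
  define P where "P = [:1, - 1:] ^ (n - 2 - l) * [:of_nat r - 1, 1 - of_nat c :: rat:]"
  have eq: "[:h (n - 2):] + (\<Sum>m<n - 1. monom (h m) (n - m - 1)) = monom s l * P"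
    using hook_sum_substitution[OF n2, of b h "of_nat c - 1" "of_nat z"] hooks(2)
    unfolding b_def h_def zr s_def P_def by simp
  have h: "h (n - 1 - j) = pc (monom s l * P) j" if "j \<ge> 1" "j < n" for j
    using coeff_hook_sum(1)[OF that, of h] unfolding eq by simp
  have h0: "h (n - 2) = pc (monom s l * P) 0"
    using coeff_hook_sum(2)[of h n] unfolding eq by simp
  have P0: "pc P 0 = of_nat r - 1" by (simp add: P_def coeff_mult_0 coeff_0_power)
  have P1: "pc P 1 = 1 - of_nat c" if "r = 1"
    unfolding P_def coeff_mult_1 using that by (simp add: coeff_0_power)
  \<comment> \<open>Since \<open>y ^ j\<close> belongs to the hook with
    \<open>m = n - 1 - j\<close>, the longest hook is the least \<open>j \<ge> 1\<close> with
    nonzero coefficient. For \<open>r \<ge> 2\<close> this is \<open>l\<close>; for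
    \<open>r = 1\<close> the constant term of \<open>P\<close> vanishes and the next one decides;
    for \<open>r = 0\<close> there are no leaves, and the nonzero constant term already gives
    \<open>h (n - 2)\<close>.\<close>
  define j where "j = (if r = 0 then 1 else if r = 1 then l + 1 else l)"
  have j: "j \<ge> 1" "j < n" using r0 c3 by (auto simp: j_def)
  have hj: "h (n - 1 - j) = (if r = 0 then - s else if r = 1 then s * (1 - of_nat c) else s * (of_nat r - 1))"
  proof -
    consider "r = 0" | "r = 1" | "r \<ge> 2" by linarith
    then show ?thesis
    proof cases
      case 1
      then have "h (n - 1 - j) = pc (monom s l * P) 0"
        using h0 by (simp add: j_def numeral_2_eq_2)
      then show ?thesis using 1 r0 by (simp add: coeff_monom_mult P0)
    next
      case 2
      then show ?thesis using h[OF j] P1 by (simp add: j_def coeff_monom_mult)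
    next
      case 3
      then show ?thesis using h[OF j] P0 by (simp add: j_def coeff_monom_mult)
    qed
  qed
  have long: "longest_hook n a m' \<longleftrightarrow> m' = n - 1 - j" for m'
  proof (rule longest_hook_unique)
    have "s \<noteq> 0" by (simp add: s_def)
    then show "a (hook n (n - 1 - j)) \<noteq> 0"
      using hj c3 unfolding h_def by (auto split: if_splits)
    show "n - 1 - j < n" using j by simp
    fix m assume m: "n - 1 - j < m" "m < n"
    show "a (hook n m) = 0"
    proof (cases "m = n - 1")
      case True
      then show ?thesis using last by (simp add: h_def)
    next
      case False
      define i where "i = n - 1 - m"
      have i: "i \<ge> 1" "i < n" "i < j" "m = n - 1 - i" using m False by (auto simp: i_def)
      \<comment> \<open>Below \<open>l\<close> the factor \<open>y ^ l\<close> gives zero; the only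
        other case is \<open>i = l\<close> with \<open>r = 1\<close>, where the constant term of
        \<open>P\<close> is 0.\<close>
      have "pc (monom s l * P) i = 0"
        using i r0 P0 unfolding coeff_monom_mult by (auto simp: j_def split: if_splits)
      then show ?thesis using h[OF i(1,2)] i(4) by (simp add: h_def)
    qed
  qed
  have "a (hook n (n - 1 - j)) = (if r = 0 then (- 1) ^ (k - 2)
         else if r = 1 then (- 1) ^ (k - 2) * (of_nat c - 1)
         else (- 1) ^ (k - 1) * (of_nat r - 1))"
  proof -
    \<comment> \<open>As \<open>n - l = k\<close>, the sign \<open>s\<close> is
      \<open>(- 1) ^ (k - 1)\<close>; the factors -1 and \<open>1 - c\<close> for
      \<open>r \<le> 1\<close> turn the exponent into \<open>k - 2\<close>.\<close>
    have "n - 1 - l = Suc (k - 2)" "k - 1 = Suc (k - 2)" using kl c3 by auto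
    then show ?thesis using hj unfolding h_def s_def by (auto simp: algebra_simps)
  qed
  moreover have "k = (if r = 0 \<or> r = 1 then n - 1 - j + 2 else n - 1 - j + 1)"
    using kl c3 r0 by (auto simp: j_def)
  ultimately show ?thesis by (simp add: long)
qed

end
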